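(* There is a constant $c(p,\gamma)<\infty$, independent of $N$ and of $k$, such that for all $N\ge2$ and all $k\in\{1,\ldots,N-1\}$, with $\bar x=(k-\tfrac12)p\ell^2/R$, $$P_N\bigl(K(\bar x;z_1,\ldots,z_N)=0\bigr)\ge 1/c(p,\gamma)>0 .$$
   Context: Setting. Let $R,\ell>0$, $p\in\mathbb{N}$ and $\gamma=\ell/R$. $\mathcal{Z}=\mathbb{R}\times[0,2\pi R]$, with $z=x+iy$. Laughlin's function. $$\Psi_N(z_1,\ldots,z_N)=\kappa_N\prod_{j<k}\bigl(e^{z_k/R}-e^{z_j/R}\bigr)^p\exp\Bigl(-\frac{1}{2\ell^2}\sum_k x_k^2\Bigr),$$ with $\kappa_N>0$. Probability measure. $P_N$ is the probability measure on $\mathcal{Z}^N$ with density proportional to $|\Psi_N(z_1,\ldots,z_N)|^2$. Particle excess function. For $\bar x=(k-\tfrac12)p\ell^2/R$ with $k\in\{1,\ldots,N-1\}$, $$K(\bar x;z_1,\ldots,z_N)=\#\{j:x_j\le\bar x\}-k .$$ *)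

theory Defs
  imports "HOL-Analysis.Analysis"
begin

definition cyl :: "real \<Rightarrow> complex set" where
  "cyl R = {z. 0 \<le> Im z \<and> Im z \<le> 2 * pi * R}"

definition cyl_measure :: "real \<Rightarrow> complex measure" where
  "cyl_measure R = restrict_space lborel (cyl R)"

text \<open>Laughlin's function (with the normalisation constant kappa_N taken as 1; it
  cancels in the probability measure). Particles are indexed 0..N-1.\<close>
definition laughlin_Psi :: "nat \<Rightarrow> real \<Rightarrow> real \<Rightarrow> nat \<Rightarrow> (nat \<Rightarrow> complex) \<Rightarrow> complex" where
  "laughlin_Psi p R l N z =
     (\<Prod>k<N. \<Prod>j<k. (exp (z k / of_real R) - exp (z j / of_real R)) ^ p)
     * of_real (exp (- (1 / (2 * l\<^sup>2)) * (\<Sum>k<N. (Re (z k))\<^sup>2)))"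

definition config_measure :: "real \<Rightarrow> nat \<Rightarrow> (nat \<Rightarrow> complex) measure" where
  "config_measure R N = PiM {..<N} (\<lambda>_. cyl_measure R)"

definition laughlin_prob :: "nat \<Rightarrow> real \<Rightarrow> real \<Rightarrow> nat \<Rightarrow> (nat \<Rightarrow> complex) measure" where
  "laughlin_prob p R l N =
     density (config_measure R N)
       (\<lambda>z. ennreal ((cmod (laughlin_Psi p R l N z))\<^sup>2)
            / (\<integral>\<^sup>+ w. ennreal ((cmod (laughlin_Psi p R l N w))\<^sup>2) \<partial>config_measure R N))"

definition particle_excess :: "nat \<Rightarrow> nat \<Rightarrow> real \<Rightarrow> (nat \<Rightarrow> complex) \<Rightarrow> int" where
  "particle_excess N k xbar z = int (card {j \<in> {..<N}. Re (z j) \<le> xbar}) - int k"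

end

theory Submission
  imports Defs "HOL-Probability.Distributions" "HOL-Real_Asymp.Real_Asymp"
begin

text \<open>
  Write \<open>X\<^sub>i = exp (z\<^sub>i / R)\<close> and \<open>a = (l / R)\<^sup>2\<close>. The density is \<open>|F(X)|\<^sup>2\<close> times a Gaussian in the
  real parts, with \<open>F\<close> a polynomial. Integrating out the angles makes distinct monomials orthogonal,
  so that the rescaled real parts become a mixture, over the exponents \<open>m\<close> of \<open>F\<close>, of independent
  Gaussians of variance \<open>a / 2\<close> centred at \<open>m\<^sub>i a\<close>.

  Split the particles into a set \<open>I\<close> of size \<open>k\<close> and its complement \<open>J\<close>, and let \<open>G\<close> be the part of \<open>F\<close>
  of lowest degree in the variables \<open>X\<^sub>i\<close>, \<open>i \<in> I\<close>: it is the product of the two separate Laughlin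
  polynomials and of \<open>X\<^sub>j\<close> to the power \<open>p k\<close> for \<open>j \<in> J\<close>. Its exponents are constrained: the \<open>r\<close>-th one of \<open>I\<close>
  (of \<open>J\<close>), counted from the cut at \<open>(k - 1/2) p a\<close>, is centred at distance at least \<open>r p a / 2\<close> to
  the left (right) of the cut. Hence in the ensemble of \<open>|G|\<^sup>2\<close> the event that \<open>I\<close> lies left and \<open>J\<close> right
  of the cut has a probability bounded below by a convergent product, and

  \<^item> on this event, rotating \<open>I\<close> jointly around the cylinder and using that the mean of \<open>|P|\<^sup>2\<close> over a circle is
    at least \<open>|P(0)|\<^sup>2\<close>, the integral of \<open>|F|\<^sup>2\<close> dominates that of \<open>|G|\<^sup>2\<close>;
  \<^item> where all of \<open>I\<close> lies left of all of \<open>J\<close>, one has \<open>|F|\<^sup>2 \<le> |G|\<^sup>2 exp (2 p \<Sum> exp (t\<^sub>i - t\<^sub>j))\<close>, and the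
    exponential has bounded mean in the ensemble of \<open>|G|\<^sup>2\<close>.

  Summing over \<open>I\<close> compares the partition function with the weight of \<open>K = 0\<close>.
\<close>

section \<open>Measure on the cylinder and rotations\<close>

text \<open>Boxes determine the measure, and on them both sides are the product of the side lengths.
  This opens the strip to Fubini in the coordinates \<open>x\<close> and \<open>y\<close>.\<close>

lemma lborel_complex_eq_distr:
  "(lborel :: complex measure) = distr (lborel \<Otimes>\<^sub>M lborel) borel (\<lambda>(x, y). Complex x y)"
proof (rule lborel_eqI)
  have meas: "(\<lambda>(x, y). Complex x y) \<in> borel_measurable (lborel \<Otimes>\<^sub>M lborel)"
    by (simp add: Complex_eq split_def)
  fix l u :: complex
  assume le: "\<And>b. b \<in> Basis \<Longrightarrow> l \<bullet> b \<le> u \<bullet> b"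
  have le': "Re l \<le> Re u" "Im l \<le> Im u"
    using le[of 1] le[of \<i>] by (auto simp: Basis_complex_def)
  have pre: "(\<lambda>(x, y). Complex x y) -` box l u \<inter> space (lborel \<Otimes>\<^sub>M lborel)
      = {Re l<..<Re u} \<times> {Im l<..<Im u}"
    by (auto simp: box_def Basis_complex_def space_pair_measure)
  show "emeasure (distr (lborel \<Otimes>\<^sub>M lborel) borel (\<lambda>(x, y). Complex x y)) (box l u)
      = (\<Prod>b\<in>Basis. (u - l) \<bullet> b)"
    using le' by (simp add: emeasure_distr[OF meas] pre lborel.emeasure_pair_measure_Times
        Basis_complex_def ennreal_mult)
qed simp

lemma cyl_measurable [measurable]: "cyl R \<in> sets borel"
  unfolding cyl_def by measurable

lemma space_cyl_measure: "space (cyl_measure R) = cyl R"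
  by (simp add: cyl_measure_def space_restrict_space)

lemma sets_cyl_measure: "sets (cyl_measure R) = sets (restrict_space borel (cyl R))"
  unfolding cyl_measure_def by (intro sets_restrict_space_cong) simp

lemma sigma_finite_cyl_measure: "sigma_finite_measure (cyl_measure R)"
  unfolding cyl_measure_def
  by (rule sigma_finite_measure_restrict_space) (simp_all add: sigma_finite_lborel)

lemma product_sigma_finite_cyl: "product_sigma_finite (\<lambda>_. cyl_measure R)"
  by (simp add: product_sigma_finite_def sigma_finite_cyl_measure)

lemma measurable_cyl_measure_borel:
  "f \<in> borel_measurable borel \<Longrightarrow> f \<in> borel_measurable (cyl_measure R)"
  unfolding cyl_measure_def by (intro measurable_restrict_space1) simp

lemma nn_integral_cyl_measure:
  assumes [measurable]: "f \<in> borel_measurable borel"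
  shows "(\<integral>\<^sup>+z. f z \<partial>cyl_measure R)
    = (\<integral>\<^sup>+x. \<integral>\<^sup>+y. f (Complex x y) * indicator {0..2 * pi * R} y \<partial>lborel \<partial>lborel)"
proof -
  have [measurable]: "(\<lambda>x. Complex (fst x) (snd x)) \<in> borel_measurable (lborel \<Otimes>\<^sub>M lborel)"
    by (simp add: Complex_eq)
  have "(\<integral>\<^sup>+z. f z \<partial>cyl_measure R) = (\<integral>\<^sup>+z. f z * indicator (cyl R) z \<partial>lborel)"
    unfolding cyl_measure_def by (subst nn_integral_restrict_space) auto
  also have "\<dots> = (\<integral>\<^sup>+(x, y). f (Complex x y) * indicator (cyl R) (Complex x y) \<partial>(lborel \<Otimes>\<^sub>M lborel))"
    by (subst lborel_complex_eq_distr, subst nn_integral_distr) (auto simp: split_def)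
  also have "\<dots> = (\<integral>\<^sup>+x. \<integral>\<^sup>+y. f (Complex x y) * indicator (cyl R) (Complex x y) \<partial>lborel \<partial>lborel)"
    by (subst lborel.nn_integral_fst[symmetric]) (auto simp: split_def)
  finally show ?thesis by (simp add: cyl_def indicator_def)
qed

lemma nn_integral_cyl_measure_Re:
  assumes [measurable]: "g \<in> borel_measurable borel" and R: "R > 0"
  shows "(\<integral>\<^sup>+z. g (Re z) \<partial>cyl_measure R) = ennreal (2 * pi * R) * (\<integral>\<^sup>+x. g x \<partial>lborel)"
  using R by (simp add: nn_integral_cyl_measure nn_integral_cmult nn_integral_multc mult.commute)

section \<open>Rotations of the cylinder\<close>

definition rotate_cyl :: "real \<Rightarrow> real \<Rightarrow> complex \<Rightarrow> complex" where
  "rotate_cyl R \<theta> z = Complex (Re z)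
     (if Im z + \<theta> \<le> 2 * pi * R then Im z + \<theta> else Im z + \<theta> - 2 * pi * R)"

lemma Re_rotate_cyl [simp]: "Re (rotate_cyl R \<theta> z) = Re z"
  by (simp add: rotate_cyl_def)

lemma rotate_cyl_in_cyl:
  "0 \<le> \<theta> \<Longrightarrow> \<theta> \<le> 2 * pi * R \<Longrightarrow> z \<in> cyl R \<Longrightarrow> rotate_cyl R \<theta> z \<in> cyl R"
  unfolding rotate_cyl_def cyl_def
  by (cases "Im z + \<theta> \<le> 2 * pi * R") (auto simp: algebra_simps)

lemma exp_rotate_cyl:
  assumes "R > 0"
  shows "exp (rotate_cyl R \<theta> z / of_real R) = cis (\<theta> / R) * exp (z / of_real R)"
proof -
  have "exp (Complex (Re z) (Im z + \<theta> - 2 * pi * R) / of_real R)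
      = exp (z / of_real R + \<i> * of_real (\<theta> / R) - 2 * of_real pi * \<i>)"
    using assms by (intro arg_cong[of _ _ exp]) (auto simp: complex_eq_iff field_simps)
  moreover have "exp (Complex (Re z) (Im z + \<theta>) / of_real R)
      = exp (z / of_real R + \<i> * of_real (\<theta> / R))"
    using assms by (intro arg_cong[of _ _ exp]) (auto simp: complex_eq_iff field_simps)
  ultimately show ?thesis
    by (simp add: rotate_cyl_def cis_conv_exp exp_add exp_diff)
qed

lemma rotate_cyl_measurable [measurable]: "rotate_cyl R \<theta> \<in> borel_measurable borel"
  unfolding rotate_cyl_def Complex_eq by measurable

text \<open>The two branches are translations onto \<open>{\<theta>..L}\<close> and
  \<open>{0<..\<theta>}\<close>. With both ends of the seam included, wrapping is a bijection only
  up to the points 0 and \<theta>, which form a null set.\<close>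

lemma nn_integral_wrap_interval:
  fixes g :: "real \<Rightarrow> ennreal"
  assumes [measurable]: "g \<in> borel_measurable borel" and "0 \<le> \<theta>" "\<theta> \<le> L"
  shows "(\<integral>\<^sup>+y. g (if y + \<theta> \<le> L then y + \<theta> else y + \<theta> - L) * indicator {0..L} y \<partial>lborel)
    = (\<integral>\<^sup>+y. g y * indicator {0..L} y \<partial>lborel)"
proof -
  have "(\<integral>\<^sup>+y. g (if y + \<theta> \<le> L then y + \<theta> else y + \<theta> - L) * indicator {0..L} y \<partial>lborel)
      = (\<integral>\<^sup>+y. g (y + \<theta>) * indicator {\<theta>..L} (y + \<theta>)
            + g (y + (\<theta> - L)) * indicator {0<..\<theta>} (y + (\<theta> - L)) \<partial>lborel)"
    using assms by (intro nn_integral_cong) (auto simp: indicator_def algebra_simps)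
  also have "\<dots> = (\<integral>\<^sup>+y. g (y + \<theta>) * indicator {\<theta>..L} (y + \<theta>) \<partial>lborel)
      + (\<integral>\<^sup>+y. g (y + (\<theta> - L)) * indicator {0<..\<theta>} (y + (\<theta> - L)) \<partial>lborel)"
    by (intro nn_integral_add) auto
  also have "(\<integral>\<^sup>+y. g (y + \<theta>) * indicator {\<theta>..L} (y + \<theta>) \<partial>lborel)
      = (\<integral>\<^sup>+y. g y * indicator {\<theta>..L} y \<partial>lborel)"
    using nn_integral_real_affine[of "\<lambda>y. g y * indicator {\<theta>..L} y" 1 \<theta>] by (simp add: add.commute)
  also have "(\<integral>\<^sup>+y. g (y + (\<theta> - L)) * indicator {0<..\<theta>} (y + (\<theta> - L)) \<partial>lborel)
      = (\<integral>\<^sup>+y. g y * indicator {0<..\<theta>} y \<partial>lborel)"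
    using nn_integral_real_affine[of "\<lambda>y. g y * indicator {0<..\<theta>} y" 1 "\<theta> - L"]
    by (simp add: add.commute)
  also have "(\<integral>\<^sup>+y. g y * indicator {\<theta>..L} y \<partial>lborel) + (\<integral>\<^sup>+y. g y * indicator {0<..\<theta>} y \<partial>lborel)
      = (\<integral>\<^sup>+y. g y * indicator {\<theta>..L} y + g y * indicator {0<..\<theta>} y \<partial>lborel)"
    by (intro nn_integral_add[symmetric]) auto
  also have "\<dots> = (\<integral>\<^sup>+y. g y * indicator {0..L} y \<partial>lborel)"
  proof (rule nn_integral_cong_AE)
    have "AE y in lborel. y \<noteq> 0 \<and> y \<noteq> \<theta>"
      using AE_lborel_singleton[of "0::real"] AE_lborel_singleton[of \<theta>] by eventually_elim auto
    then show "AE y in lborel. g y * indicator {\<theta>..L} y + g y * indicator {0<..\<theta>} y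
        = g y * indicator {0..L} y"
      by eventually_elim (use assms in \<open>auto simp: indicator_def\<close>)
  qed
  finally show ?thesis .
qed

lemma distr_rotate_cyl:
  assumes \<theta>: "0 \<le> \<theta>" "\<theta> \<le> 2 * pi * R"
  shows "rotate_cyl R \<theta> \<in> cyl_measure R \<rightarrow>\<^sub>M cyl_measure R"
    and "distr (cyl_measure R) (cyl_measure R) (rotate_cyl R \<theta>) = cyl_measure R"
proof -
  have "rotate_cyl R \<theta> \<in> cyl_measure R \<rightarrow>\<^sub>M restrict_space borel (cyl R)"
    using rotate_cyl_in_cyl[OF \<theta>]
    by (intro measurable_restrict_space2 measurable_cyl_measure_borel) (auto simp: space_cyl_measure)
  then show meas [measurable]: "rotate_cyl R \<theta> \<in> cyl_measure R \<rightarrow>\<^sub>M cyl_measure R"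
    by (simp add: sets_cyl_measure cong: measurable_cong_sets)
  show "distr (cyl_measure R) (cyl_measure R) (rotate_cyl R \<theta>) = cyl_measure R"
  proof (rule measure_eqI)
    fix A assume A: "A \<in> sets (distr (cyl_measure R) (cyl_measure R) (rotate_cyl R \<theta>))"
    then have A': "A \<in> sets (cyl_measure R)" by simp
    then have [measurable]: "A \<in> sets borel"
      by (auto simp: sets_cyl_measure sets_restrict_space_iff)
    have "emeasure (distr (cyl_measure R) (cyl_measure R) (rotate_cyl R \<theta>)) A
        = (\<integral>\<^sup>+z. indicator A z \<partial>distr (cyl_measure R) (cyl_measure R) (rotate_cyl R \<theta>))"
      using A by simp
    also have "\<dots> = (\<integral>\<^sup>+z. indicator A (rotate_cyl R \<theta> z) \<partial>cyl_measure R)"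
      using A' by (subst nn_integral_distr) auto
    also have "\<dots> = (\<integral>\<^sup>+x. \<integral>\<^sup>+y. indicator A (rotate_cyl R \<theta> (Complex x y)) * indicator {0..2 * pi * R} y \<partial>lborel \<partial>lborel)"
      by (subst nn_integral_cyl_measure) auto
    also have "\<dots> = (\<integral>\<^sup>+x. \<integral>\<^sup>+y. indicator A (Complex x y) * indicator {0..2 * pi * R} y \<partial>lborel \<partial>lborel)"
    proof (rule nn_integral_cong)
      fix x :: real
      have "(\<lambda>y. Complex x y) \<in> borel_measurable borel" by (simp add: Complex_eq)
      then have "(\<lambda>y. indicator A (Complex x y) :: ennreal) \<in> borel_measurable borel" by measurable
      from nn_integral_wrap_interval[OF this \<theta>]
      show "(\<integral>\<^sup>+y. indicator A (rotate_cyl R \<theta> (Complex x y)) * indicator {0..2 * pi * R} y \<partial>lborel)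
        = (\<integral>\<^sup>+y. indicator A (Complex x y) * indicator {0..2 * pi * R} y \<partial>lborel)"
        by (simp add: rotate_cyl_def cong: if_cong)
    qed
    also have "\<dots> = (\<integral>\<^sup>+z. indicator A z \<partial>cyl_measure R)"
      by (subst nn_integral_cyl_measure) auto
    also have "\<dots> = emeasure (cyl_measure R) A" using A' by simp
    finally show "emeasure (distr (cyl_measure R) (cyl_measure R) (rotate_cyl R \<theta>)) A = emeasure (cyl_measure R) A" .
  qed simp
qed

text \<open>Every particle has its own angle: independent rotations separate monomials, while a
  joint rotation of one group uses a common angle there and angle 0 elsewhere.\<close>

definition rotate_config :: "real \<Rightarrow> 'i set \<Rightarrow> ('i \<Rightarrow> real) \<Rightarrow> ('i \<Rightarrow> complex) \<Rightarrow> 'i \<Rightarrow> complex" where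
  "rotate_config R U \<theta> z = (\<lambda>i\<in>U. rotate_cyl R (\<theta> i) (z i))"

lemma nn_integral_rotate_config:
  assumes fin: "finite U" and \<theta>: "\<And>i. i \<in> U \<Longrightarrow> 0 \<le> \<theta> i \<and> \<theta> i \<le> 2 * pi * R"
    and f: "f \<in> borel_measurable (PiM U (\<lambda>_. cyl_measure R))"
  shows "rotate_config R U \<theta> \<in> PiM U (\<lambda>_. cyl_measure R) \<rightarrow>\<^sub>M PiM U (\<lambda>_. cyl_measure R)"
    and "(\<integral>\<^sup>+z. f (rotate_config R U \<theta> z) \<partial>PiM U (\<lambda>_. cyl_measure R))
      = (\<integral>\<^sup>+z. f z \<partial>PiM U (\<lambda>_. cyl_measure R))"
proof -
  let ?\<mu> = "PiM U (\<lambda>_. cyl_measure R)"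
  interpret product_sigma_finite "\<lambda>_. cyl_measure R" by (rule product_sigma_finite_cyl)
  show meas: "rotate_config R U \<theta> \<in> ?\<mu> \<rightarrow>\<^sub>M ?\<mu>"
    unfolding rotate_config_def
    using \<theta> by (intro measurable_restrict measurable_compose[OF measurable_component_singleton]
        distr_rotate_cyl(1)) auto
  have "distr ?\<mu> ?\<mu> (rotate_config R U \<theta>) = ?\<mu>"
  proof (rule PiM_eqI[OF fin])
    fix A assume A: "\<And>i. i \<in> U \<Longrightarrow> A i \<in> sets (cyl_measure R)"
    define B where "B i = rotate_cyl R (\<theta> i) -` A i \<inter> cyl R" for i
    have B: "B i \<in> sets (cyl_measure R)" "emeasure (cyl_measure R) (B i) = emeasure (cyl_measure R) (A i)"
      if "i \<in> U" for i
    proof -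
      have *: "0 \<le> \<theta> i" "\<theta> i \<le> 2 * pi * R" using \<theta> that by auto
      show "B i \<in> sets (cyl_measure R)"
        using measurable_sets[OF distr_rotate_cyl(1)[OF *] A[OF that]]
        by (simp add: B_def space_cyl_measure)
      have "emeasure (distr (cyl_measure R) (cyl_measure R) (rotate_cyl R (\<theta> i))) (A i)
        = emeasure (cyl_measure R) (B i)"
        unfolding B_def
        by (subst emeasure_distr[OF distr_rotate_cyl(1)[OF *] A[OF that]]) (simp add: space_cyl_measure)
      then show "emeasure (cyl_measure R) (B i) = emeasure (cyl_measure R) (A i)"
        by (simp add: distr_rotate_cyl(2)[OF *])
    qed
    have PE: "Pi\<^sub>E U A \<in> sets ?\<mu>" using A fin by (intro sets_PiM_I_finite) auto
    have "rotate_config R U \<theta> -` Pi\<^sub>E U A \<inter> space ?\<mu> = Pi\<^sub>E U B"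
      by (auto simp: rotate_config_def B_def space_PiM space_cyl_measure PiE_iff)
    then show "emeasure (distr ?\<mu> ?\<mu> (rotate_config R U \<theta>)) (Pi\<^sub>E U A) = (\<Prod>i\<in>U. emeasure (cyl_measure R) (A i))"
      using B fin by (simp add: emeasure_distr[OF meas PE] emeasure_PiM)
  qed simp
  then show "(\<integral>\<^sup>+z. f (rotate_config R U \<theta> z) \<partial>?\<mu>) = (\<integral>\<^sup>+z. f z \<partial>?\<mu>)"
    using nn_integral_distr[OF meas, of f] f by simp
qed

section \<open>Averages over roots of unity\<close>

text \<open>The summand is the \<open>s\<close>-th power of a single \<open>q\<close>-th root of
  unity \<open>w\<close>, so the sum is geometric and vanishes unless \<open>w = 1\<close>.\<close>

lemma cis_root_unity_sum:
  fixes q m n :: nat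
  assumes "m < q" "n < q"
  shows "(\<Sum>s<q. cis (2 * pi * real s / real q) ^ m * cnj (cis (2 * pi * real s / real q) ^ n))
    = (if m = n then of_nat q else 0)"
proof -
  define w where "w = cis (2 * pi * (real m - real n) / real q)"
  have q: "q > 0" using assms by simp
  have term_eq: "cis (2 * pi * real s / real q) ^ m * cnj (cis (2 * pi * real s / real q) ^ n) = w ^ s" for s
    by (simp add: w_def Complex.DeMoivre cis_mult cis_cnj flip: complex_cnj_power)
       (rule arg_cong[of _ _ cis], use q in \<open>simp add: field_simps\<close>)
  show ?thesis
  proof (cases "m = n")
    case True
    then show ?thesis unfolding term_eq by (simp add: w_def)
  next
    case False
    \<comment> \<open>\<open>w = 1\<close> would make \<open>m - n\<close> a nonzero multiple of
      \<open>q\<close>, although both exponents lie below \<open>q\<close>.\<close>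
    have "w \<noteq> 1"
    proof
      assume "w = 1"
      then have "cos (2 * pi * (real m - real n) / real q) = 1"
        by (auto simp: w_def complex_eq_iff)
      then obtain j :: int where "2 * pi * (real m - real n) / real q = of_int j * 2 * pi"
        using cos_one_2pi_int by blast
      then have "(2 * pi) * (real m - real n) = (2 * pi) * (of_int j * real q)"
        using q by (simp add: field_simps)
      then have "real m - real n = of_int j * real q"
        unfolding mult_cancel_left by simp
      then have "real_of_int (int m - int n) = of_int (j * int q)" by simp
      then have eq: "int m - int n = j * int q" by (simp only: of_int_eq_iff)
      then have "j \<noteq> 0" using False by auto
      then have "\<bar>j * int q\<bar> \<ge> int q" by (simp add: abs_mult mult_le_cancel_right1) linarith
      then show False using eq assms by linarith
    qed
    moreover have "w ^ q = 1"
    proof -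
      have "w ^ q = cis (2 * pi * of_int (int m - int n))"
        using q by (simp add: w_def Complex.DeMoivre)
      then show ?thesis by (metis cis_multiple_2pi Ints_of_int)
    qed
    ultimately show ?thesis using False unfolding term_eq by (simp add: sum_gp_strict)
  qed
qed

text \<open>A finite grid of angles suffices: once every exponent is below \<open>q\<close>, roots
  of unity separate monomials as the full torus does, and only diagonal terms of the expanded square
  survive. \<open>ext\<close> excludes exponents that differ only outside \<open>U\<close>, since
  these give the same monomial.\<close>

lemma parseval_roots_of_unity:
  fixes X :: "'i \<Rightarrow> complex" and a :: "('i \<Rightarrow> nat) \<Rightarrow> complex"
  assumes U: "finite U" and bound: "\<And>m i. m \<in> M \<Longrightarrow> i \<in> U \<Longrightarrow> m i < q"
    and ext: "\<And>m n. m \<in> M \<Longrightarrow> n \<in> M \<Longrightarrow> (\<And>i. i \<in> U \<Longrightarrow> m i = n i) \<Longrightarrow> m = n"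
  shows "(\<Sum>s\<in>Pi\<^sub>E U (\<lambda>_. {..<q}).
      (cmod (\<Sum>m\<in>M. a m * (\<Prod>i\<in>U. (cis (2 * pi * real (s i) / real q) * X i) ^ m i)))\<^sup>2)
    = real q ^ card U * (\<Sum>m\<in>M. (cmod (a m))\<^sup>2 * (\<Prod>i\<in>U. cmod (X i) ^ (2 * m i)))"
    (is "?L = ?R")
proof -
  define e where "e s n = cis (2 * pi * real s / real q) ^ n" for s n :: nat
  define b where "b m = a m * (\<Prod>i\<in>U. X i ^ m i)" for m
  have orth: "(\<Sum>s\<in>Pi\<^sub>E U (\<lambda>_. {..<q}). (\<Prod>i\<in>U. e (s i) (m i) * cnj (e (s i) (n i))))
      = (if m = n then of_nat q ^ card U else 0)" if mn: "m \<in> M" "n \<in> M" for m n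
  proof -
    have "(\<Sum>s\<in>Pi\<^sub>E U (\<lambda>_. {..<q}). (\<Prod>i\<in>U. e (s i) (m i) * cnj (e (s i) (n i))))
        = (\<Prod>i\<in>U. \<Sum>s<q. e s (m i) * cnj (e s (n i)))"
      using U by (subst prod_sum_PiE) auto
    also have "\<dots> = (\<Prod>i\<in>U. if m i = n i then of_nat q else 0)"
      unfolding e_def using that bound by (intro prod.cong refl cis_root_unity_sum) auto
    also have "\<dots> = (if m = n then of_nat q ^ card U else 0)"
    proof (cases "m = n")
      case False
      then obtain i where "i \<in> U" "m i \<noteq> n i" using ext[OF mn] by blast
      then show ?thesis using U False by (subst prod_zero) auto
    qed simp
    finally show ?thesis .
  qed
  have split: "(\<Sum>m\<in>M. a m * (\<Prod>i\<in>U. (cis (2 * pi * real (s i) / real q) * X i) ^ m i))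
      = (\<Sum>m\<in>M. b m * (\<Prod>i\<in>U. e (s i) (m i)))" for s
    by (simp add: b_def e_def power_mult_distrib prod.distrib mult_ac)
  have "complex_of_real ?L
      = (\<Sum>s\<in>Pi\<^sub>E U (\<lambda>_. {..<q}). (\<Sum>m\<in>M. b m * (\<Prod>i\<in>U. e (s i) (m i)))
          * cnj (\<Sum>m\<in>M. b m * (\<Prod>i\<in>U. e (s i) (m i))))"
    by (simp only: split of_real_sum complex_norm_square)
  also have "\<dots> = (\<Sum>s\<in>Pi\<^sub>E U (\<lambda>_. {..<q}). \<Sum>m\<in>M. \<Sum>n\<in>M.
      b m * cnj (b n) * (\<Prod>i\<in>U. e (s i) (m i) * cnj (e (s i) (n i))))"
    by (simp add: sum_product cnj_sum cnj_prod prod.distrib mult_ac)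
  also have "\<dots> = (\<Sum>m\<in>M. \<Sum>s\<in>Pi\<^sub>E U (\<lambda>_. {..<q}). \<Sum>n\<in>M.
      b m * cnj (b n) * (\<Prod>i\<in>U. e (s i) (m i) * cnj (e (s i) (n i))))"
    by (rule sum.swap)
  also have "\<dots> = (\<Sum>m\<in>M. \<Sum>n\<in>M. \<Sum>s\<in>Pi\<^sub>E U (\<lambda>_. {..<q}).
      b m * cnj (b n) * (\<Prod>i\<in>U. e (s i) (m i) * cnj (e (s i) (n i))))"
    by (intro sum.cong refl sum.swap)
  also have "\<dots> = (\<Sum>m\<in>M. \<Sum>n\<in>M. b m * cnj (b n) *
      (\<Sum>s\<in>Pi\<^sub>E U (\<lambda>_. {..<q}). \<Prod>i\<in>U. e (s i) (m i) * cnj (e (s i) (n i))))"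
    by (simp only: sum_distrib_left)
  also have "\<dots> = (\<Sum>m\<in>M. \<Sum>n\<in>M. if m = n then b m * cnj (b n) * of_nat q ^ card U else 0)"
    by (intro sum.cong refl) (simp add: orth)
  also have "\<dots> = (\<Sum>m\<in>M. b m * cnj (b m) * of_nat q ^ card U)"
  proof (cases "finite M")
    case True then show ?thesis by (intro sum.cong refl) (simp add: sum.delta)
  qed simp
  also have "\<dots> = complex_of_real (\<Sum>m\<in>M. (cmod (b m))\<^sup>2 * real q ^ card U)"
    by (simp only: of_real_sum of_real_mult complex_norm_square) simp
  finally have "?L = (\<Sum>m\<in>M. (cmod (b m))\<^sup>2 * real q ^ card U)"
    by (simp only: of_real_eq_iff)
  also have "\<dots> = ?R"
  proof -
    have "(cmod (b m))\<^sup>2 = (cmod (a m))\<^sup>2 * (\<Prod>i\<in>U. cmod (X i) ^ (2 * m i))" for m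
      by (simp add: b_def norm_mult norm_power power_mult_distrib prod_power_distrib mult.commute[of 2]
          power_mult flip: prod_norm)
    then show ?thesis by (simp add: sum_distrib_left mult_ac)
  qed
  finally show ?thesis .
qed

text \<open>Below degree \<open>q\<close>, the mean of \<open>P\<close> over the \<open>q\<close>-th
  roots of unity is exactly its value at 0; Cauchy-Schwarz passes from the mean to the mean
  square.\<close>

lemma mean_square_ge_value_at_0:
  fixes P :: "complex poly"
  assumes "degree P < q"
  shows "real q * (cmod (poly P 0))\<^sup>2 \<le> (\<Sum>s<q. (cmod (poly P (cis (2 * pi * real s / real q))))\<^sup>2)"
proof -
  have q: "0 < q" using assms by simp
  have "(\<Sum>s<q. poly P (cis (2 * pi * real s / real q)))
      = (\<Sum>n\<le>degree P. coeff P n * (\<Sum>s<q. cis (2 * pi * real s / real q) ^ n * cnj (cis (2 * pi * real s / real q) ^ 0)))"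
    by (simp add: poly_altdef sum_distrib_left) (rule sum.swap)
  also have "\<dots> = (\<Sum>n\<le>degree P. if n = 0 then coeff P 0 * of_nat q else 0)"
    using assms q by (intro sum.cong refl, subst cis_root_unity_sum) auto
  also have "\<dots> = of_nat q * poly P 0"
    by (simp add: poly_0_coeff_0)
  finally have "real q * cmod (poly P 0) = cmod (\<Sum>s<q. poly P (cis (2 * pi * real s / real q)))"
    by (simp add: norm_mult)
  also have "\<dots> \<le> (\<Sum>s<q. cmod (poly P (cis (2 * pi * real s / real q))))"
    by (rule norm_sum)
  finally have "(real q * cmod (poly P 0))\<^sup>2 \<le> (\<Sum>s<q. cmod (poly P (cis (2 * pi * real s / real q))))\<^sup>2"
    by (intro power_mono) auto
  also have "\<dots> \<le> (\<Sum>s<q. (cmod (poly P (cis (2 * pi * real s / real q))))\<^sup>2) * real q"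
    using sum_squared_le_sum_of_squares[of "\<lambda>s. cmod (poly P (cis (2 * pi * real s / real q)))" "{..<q}"] by simp
  finally show ?thesis using q by (simp add: power_mult_distrib power2_eq_square mult_ac)
qed

section \<open>Averaging integrals over rotations\<close>

lemma measurable_config_component [measurable (raw)]:
  assumes "i \<in> U"
  shows "(\<lambda>z. z i) \<in> borel_measurable (PiM U (\<lambda>_. cyl_measure R))"
  using measurable_compose[OF measurable_component_singleton[OF assms, of "\<lambda>_. cyl_measure R"]
      measurable_cyl_measure_borel[of "\<lambda>z::complex. z" R]] by simp

lemma nn_integral_mean_rotations:
  fixes f :: "('i \<Rightarrow> complex) \<Rightarrow> ennreal"
  assumes "finite U" "finite S" and \<theta>: "\<And>s i. s \<in> S \<Longrightarrow> i \<in> U \<Longrightarrow> 0 \<le> \<theta> s i \<and> \<theta> s i \<le> 2 * pi * R"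
    and f: "f \<in> borel_measurable (PiM U (\<lambda>_. cyl_measure R))"
  shows "of_nat (card S) * (\<integral>\<^sup>+z. f z \<partial>PiM U (\<lambda>_. cyl_measure R))
    = (\<integral>\<^sup>+z. (\<Sum>s\<in>S. f (rotate_config R U (\<theta> s) z)) \<partial>PiM U (\<lambda>_. cyl_measure R))"
proof -
  let ?\<mu> = "PiM U (\<lambda>_. cyl_measure R)"
  have "(\<integral>\<^sup>+z. (\<Sum>s\<in>S. f (rotate_config R U (\<theta> s) z)) \<partial>?\<mu>)
      = (\<Sum>s\<in>S. \<integral>\<^sup>+z. f (rotate_config R U (\<theta> s) z) \<partial>?\<mu>)"
    using assms by (intro nn_integral_sum measurable_compose[OF nn_integral_rotate_config(1) f]) auto
  also have "\<dots> = (\<Sum>s\<in>S. \<integral>\<^sup>+z. f z \<partial>?\<mu>)"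
    using assms by (intro sum.cong refl nn_integral_rotate_config(2)) auto
  finally show ?thesis by simp
qed

text \<open>Rather than integrating out the angles, the integrand is summed over a grid of rotated
  copies, all with the same integral. The factor \<open>h\<close> sees real parts only and is
  unchanged, so the finite Parseval identity applies pointwise.\<close>

lemma nn_integral_parseval:
  fixes h :: "('i \<Rightarrow> complex) \<Rightarrow> ennreal" and a :: "('i \<Rightarrow> nat) \<Rightarrow> complex"
  assumes U: "finite U" and M: "finite M" and R: "R > 0"
    and supp: "\<And>m i. m \<in> M \<Longrightarrow> i \<notin> U \<Longrightarrow> m i = 0"
    and h [measurable]: "h \<in> borel_measurable (PiM U (\<lambda>_. cyl_measure R))"
    and h_Re: "\<And>z w. (\<And>i. i \<in> U \<Longrightarrow> Re (z i) = Re (w i)) \<Longrightarrow> h z = h w"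
  shows "(\<integral>\<^sup>+z. ennreal ((cmod (\<Sum>m\<in>M. a m * (\<Prod>i\<in>U. exp (z i / of_real R) ^ m i)))\<^sup>2) * h z \<partial>PiM U (\<lambda>_. cyl_measure R))
    = (\<Sum>m\<in>M. ennreal ((cmod (a m))\<^sup>2)
        * (\<integral>\<^sup>+z. (\<Prod>i\<in>U. ennreal (exp (2 * real (m i) * Re (z i) / R))) * h z \<partial>PiM U (\<lambda>_. cyl_measure R)))"
proof -
  define f where "f z = ennreal ((cmod (\<Sum>m\<in>M. a m * (\<Prod>i\<in>U. exp (z i / of_real R) ^ m i)))\<^sup>2) * h z" for z
  have f [measurable]: "f \<in> borel_measurable (PiM U (\<lambda>_. cyl_measure R))"
    using h unfolding f_def by measurable
  \<comment> \<open>The sum of all exponents plus one exceeds each single exponent.\<close>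
  define q where "q = Suc (\<Sum>m\<in>M. \<Sum>i\<in>U. m i)"
  have mq: "m i < q" if "m \<in> M" "i \<in> U" for m i
  proof -
    have "m i \<le> (\<Sum>i\<in>U. m i)" using that U by (intro member_le_sum) auto
    also have "\<dots> \<le> (\<Sum>m\<in>M. \<Sum>i\<in>U. m i)" using that M by (intro member_le_sum) auto
    finally show "m i < q" by (simp add: q_def)
  qed
  have q0: "q > 0" by (simp add: q_def)
  let ?S = "Pi\<^sub>E U (\<lambda>_. {..<q})"
  define \<theta> where "\<theta> s i = R * (2 * pi * real (s i) / real q)" for s :: "'i \<Rightarrow> nat" and i
  have S: "finite ?S" "card ?S = q ^ card U" using U by (auto simp: card_PiE finite_PiE)
  have \<theta>: "0 \<le> \<theta> s i \<and> \<theta> s i \<le> 2 * pi * R" if "s \<in> ?S" "i \<in> U" for s i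
  proof -
    have "s i < q" using that by (auto simp: PiE_iff)
    then have "real (s i) / real q \<le> 1" by simp
    then have "2 * pi * R * (real (s i) / real q) \<le> 2 * pi * R"
      using R by (intro mult_left_le) auto
    then show ?thesis using R by (simp add: \<theta>_def mult_ac)
  qed
  define g where "g m z = ennreal ((cmod (a m))\<^sup>2) * ((\<Prod>i\<in>U. ennreal (exp (2 * real (m i) * Re (z i) / R))) * h z)" for m z
  have g_meas: "(\<lambda>z. (\<Prod>i\<in>U. ennreal (exp (2 * real (m i) * Re (z i) / R))) * h z) \<in> borel_measurable (PiM U (\<lambda>_. cyl_measure R))" for m
    using h by measurable
  have pointwise: "(\<Sum>s\<in>?S. f (rotate_config R U (\<theta> s) z)) = of_nat (q ^ card U) * (\<Sum>m\<in>M. g m z)" for z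
  proof -
    let ?X = "\<lambda>i. exp (z i / of_real R)"
    have "f (rotate_config R U (\<theta> s) z)
        = ennreal ((cmod (\<Sum>m\<in>M. a m * (\<Prod>i\<in>U. (cis (2 * pi * real (s i) / real q) * ?X i) ^ m i)))\<^sup>2) * h z"
      for s
    proof -
      have "h (rotate_config R U (\<theta> s) z) = h z"
        by (rule h_Re) (simp add: rotate_config_def)
      moreover have "exp (rotate_config R U (\<theta> s) z i / of_real R) = cis (2 * pi * real (s i) / real q) * ?X i"
        if "i \<in> U" for i
        using that R by (simp add: rotate_config_def exp_rotate_cyl \<theta>_def)
      ultimately show ?thesis unfolding f_def by (simp cong: prod.cong)
    qed
    then have "(\<Sum>s\<in>?S. f (rotate_config R U (\<theta> s) z)) = ennreal (\<Sum>s\<in>?S.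
        (cmod (\<Sum>m\<in>M. a m * (\<Prod>i\<in>U. (cis (2 * pi * real (s i) / real q) * ?X i) ^ m i)))\<^sup>2) * h z"
      by (simp add: sum_distrib_right flip: sum_ennreal)
    also have "(\<Sum>s\<in>?S. (cmod (\<Sum>m\<in>M. a m * (\<Prod>i\<in>U. (cis (2 * pi * real (s i) / real q) * ?X i) ^ m i)))\<^sup>2)
        = real q ^ card U * (\<Sum>m\<in>M. (cmod (a m))\<^sup>2 * (\<Prod>i\<in>U. cmod (?X i) ^ (2 * m i)))"
    proof (rule parseval_roots_of_unity)
      fix m n assume "m \<in> M" "n \<in> M" "\<And>i. i \<in> U \<Longrightarrow> m i = n i"
      then have "m i = n i" for i by (cases "i \<in> U") (auto simp: supp)
      then show "m = n" by (rule ext)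
    qed (use U mq in auto)
    also have "\<dots> = real q ^ card U * (\<Sum>m\<in>M. (cmod (a m))\<^sup>2 * (\<Prod>i\<in>U. exp (2 * real (m i) * Re (z i) / R)))"
      by (simp add: mult_ac flip: exp_of_nat_mult)
    also have "ennreal \<dots> = of_nat (q ^ card U)
        * (\<Sum>m\<in>M. ennreal ((cmod (a m))\<^sup>2) * (\<Prod>i\<in>U. ennreal (exp (2 * real (m i) * Re (z i) / R))))"
      by (simp add: ennreal_mult sum_nonneg prod_nonneg prod_ennreal ennreal_of_nat_eq_real_of_nat
          flip: sum_ennreal)
    also have "\<dots> * h z = of_nat (q ^ card U) * (\<Sum>m\<in>M. g m z)"
      unfolding g_def by (simp only: mult.assoc sum_distrib_right)
    finally show ?thesis .
  qed
  have "of_nat (q ^ card U) * (\<integral>\<^sup>+z. f z \<partial>PiM U (\<lambda>_. cyl_measure R)) = (\<integral>\<^sup>+z. of_nat (q ^ card U) * (\<Sum>m\<in>M. g m z) \<partial>PiM U (\<lambda>_. cyl_measure R))"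
    using nn_integral_mean_rotations[where \<theta>=\<theta>, OF U S(1) \<theta> f]
    unfolding pointwise S(2) by simp
  also have "\<dots> = of_nat (q ^ card U) * (\<Sum>m\<in>M. ennreal ((cmod (a m))\<^sup>2)
        * (\<integral>\<^sup>+z. (\<Prod>i\<in>U. ennreal (exp (2 * real (m i) * Re (z i) / R))) * h z \<partial>PiM U (\<lambda>_. cyl_measure R)))"
    unfolding g_def using g_meas by (simp add: nn_integral_cmult nn_integral_sum)
  \<comment> \<open>The number of grid points is nonzero and finite, so it may be cancelled in the
    extended reals.\<close>
  finally show ?thesis
    using q0 of_nat_less_top[of "q ^ card U"] unfolding f_def
    by (subst (asm) ennreal_mult_cancel_left) (auto simp del: of_nat_power)
qed

section \<open>Expansion of edge products\<close>

lemma sum_card_fibres: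
  assumes "finite S" "finite B"
  shows "(\<Sum>i\<in>S. card {x\<in>B. \<phi> x = i}) = card {x\<in>B. \<phi> x \<in> S}"
proof -
  have "{x\<in>B. \<phi> x \<in> S} = (\<Union>i\<in>S. {x\<in>B. \<phi> x = i})" by auto
  then show ?thesis using assms by (simp add: card_UN_disjoint disjoint_iff)
qed

lemma prod_eq_prod_power_fibres:
  fixes X :: "'i \<Rightarrow> 'c::comm_monoid_mult"
  assumes "finite U" "finite B" "\<phi> ` B \<subseteq> U"
  shows "(\<Prod>x\<in>B. X (\<phi> x)) = (\<Prod>i\<in>U. X i ^ card {x\<in>B. \<phi> x = i})"
proof -
  have "(\<Prod>x\<in>B. X (\<phi> x)) = (\<Prod>i\<in>U. \<Prod>x\<in>{x\<in>B. \<phi> x = i}. X (\<phi> x))"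
    using assms by (intro prod.group[symmetric])
  also have "\<dots> = (\<Prod>i\<in>U. X i ^ card {x\<in>B. \<phi> x = i})"
    by (intro prod.cong refl) simp
  finally show ?thesis .
qed

text \<open>Every monomial of the expanded product picks one endpoint of each edge, \<open>p\<close> times.\<close>

lemma edge_product_expansion:
  fixes E :: "('i \<times> 'i) set" and c :: "'i \<Rightarrow> nat" and p :: nat
  assumes U: "finite U" and E: "E \<subseteq> U \<times> U"
  obtains M and a :: "('i \<Rightarrow> nat) \<Rightarrow> complex" where "finite M"
    and "\<forall>m\<in>M. \<forall>i. i \<notin> U \<longrightarrow> m i = 0"
    and "\<forall>m\<in>M. \<forall>S. S \<subseteq> U \<longrightarrow> p * card {e\<in>E. fst e \<in> S \<and> snd e \<in> S} + sum c S \<le> sum m S"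
    and "\<forall>m\<in>M. \<forall>S. S \<subseteq> U \<longrightarrow> sum m S \<le> p * card {e\<in>E. fst e \<in> S \<or> snd e \<in> S} + sum c S"
    and "\<forall>X. (\<Prod>e\<in>E. (X (snd e) - X (fst e)) ^ p) * (\<Prod>i\<in>U. X i ^ c i) = (\<Sum>m\<in>M. a m * (\<Prod>i\<in>U. X i ^ m i))"
proof -
  have finE: "finite E" using U E finite_subset by blast
  \<comment> \<open>\<open>A\<close> holds \<open>p\<close> copies of each edge, one for each linear
    factor. A subset \<open>B\<close> lists the copies that contribute their first endpoint, with a
    minus sign; the others contribute the second.\<close>
  define A where "A = E \<times> {..<p}"
  have finA: "finite A" using finE by (simp add: A_def)
  define mm where "mm B i = (if i \<in> U then card {x\<in>B. fst (fst x) = i} + card {x\<in>A-B. snd (fst x) = i} + c i else 0)"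
    for B i
  \<comment> \<open>Different choices \<open>B\<close> may give the same exponents, so their signs
    are collected into one coefficient.\<close>
  define a where "a m = (\<Sum>B\<in>{B\<in>Pow A. mm B = m}. (-1) ^ card B :: complex)" for m
  have sum_mm: "sum (mm B) S = card {x\<in>B. fst (fst x) \<in> S} + card {x\<in>A-B. snd (fst x) \<in> S} + sum c S"
    if "B \<subseteq> A" "S \<subseteq> U" for B S
  proof -
    have "finite S" "finite B" "finite (A - B)" using that U finA by (auto intro: finite_subset)
    moreover have "sum (mm B) S = (\<Sum>i\<in>S. card {x\<in>B. fst (fst x) = i} + card {x\<in>A-B. snd (fst x) = i} + c i)"
      using that by (intro sum.cong) (auto simp: mm_def)
    ultimately show ?thesis by (simp only: sum.distrib sum_card_fibres)
  qed
  show ?thesis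
  proof (rule that[of "mm ` Pow A" a]; (intro ballI allI impI)?)
    show "finite (mm ` Pow A)" using finA by simp
    show "m i = 0" if "m \<in> mm ` Pow A" "i \<notin> U" for m i using that by (auto simp: mm_def)
    show "p * card {e\<in>E. fst e \<in> S \<and> snd e \<in> S} + sum c S \<le> sum m S"
      if m: "m \<in> mm ` Pow A" and S: "S \<subseteq> U" for m S
    proof -
      obtain B where B: "B \<subseteq> A" "m = mm B" using m by auto
      \<comment> \<open>A copy of an edge inside \<open>S\<close> adds one to the degree in
        \<open>S\<close> whichever endpoint is picked.\<close>
      have "p * card {e\<in>E. fst e \<in> S \<and> snd e \<in> S} = card ({e\<in>E. fst e \<in> S \<and> snd e \<in> S} \<times> {..<p})"
        by (simp add: card_cartesian_product)
      also have "\<dots> \<le> card ({x\<in>B. fst (fst x) \<in> S} \<union> {x\<in>A-B. snd (fst x) \<in> S})"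
        using finA B by (intro card_mono) (auto simp: A_def intro: finite_subset)
      also have "\<dots> \<le> card {x\<in>B. fst (fst x) \<in> S} + card {x\<in>A-B. snd (fst x) \<in> S}"
        by (rule card_Un_le)
      finally show ?thesis using sum_mm[OF B(1) S] B(2) by simp
    qed
    show "sum m S \<le> p * card {e\<in>E. fst e \<in> S \<or> snd e \<in> S} + sum c S"
      if m: "m \<in> mm ` Pow A" and S: "S \<subseteq> U" for m S
    proof -
      obtain B where B: "B \<subseteq> A" "m = mm B" using m by auto
      \<comment> \<open>A copy adds at most one to the degree in \<open>S\<close>, and only if its
        edge meets \<open>S\<close>.\<close>
      have "card {x\<in>B. fst (fst x) \<in> S} + card {x\<in>A-B. snd (fst x) \<in> S}
        = card ({x\<in>B. fst (fst x) \<in> S} \<union> {x\<in>A-B. snd (fst x) \<in> S})"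
        using finA B by (intro card_Un_disjoint[symmetric]) (auto intro: finite_subset)
      also have "\<dots> \<le> card ({e\<in>E. fst e \<in> S \<or> snd e \<in> S} \<times> {..<p})"
        using finE B by (intro card_mono) (auto simp: A_def)
      also have "\<dots> = p * card {e\<in>E. fst e \<in> S \<or> snd e \<in> S}"
        by (simp add: card_cartesian_product)
      finally show ?thesis using sum_mm[OF B(1) S] B(2) by simp
    qed
    show "(\<Prod>e\<in>E. (X (snd e) - X (fst e)) ^ p) * (\<Prod>i\<in>U. X i ^ c i)
        = (\<Sum>m\<in>mm ` Pow A. a m * (\<Prod>i\<in>U. X i ^ m i))" for X
    proof -
      have "(\<Prod>e\<in>E. (X (snd e) - X (fst e)) ^ p) = (\<Prod>x\<in>A. X (snd (fst x)) - X (fst (fst x)))"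
        unfolding A_def by (subst prod.cartesian_product[symmetric, unfolded split_def]) simp
      also have "\<dots> = (\<Sum>B\<in>Pow A. (-1) ^ card B * (\<Prod>x\<in>B. X (fst (fst x))) * (\<Prod>x\<in>A-B. X (snd (fst x))))"
        by (rule prod_diff_conv_sum[OF finA])
      finally have "(\<Prod>e\<in>E. (X (snd e) - X (fst e)) ^ p) * (\<Prod>i\<in>U. X i ^ c i)
        = (\<Sum>B\<in>Pow A. (-1) ^ card B * (\<Prod>x\<in>B. X (fst (fst x))) * (\<Prod>x\<in>A-B. X (snd (fst x))) * (\<Prod>i\<in>U. X i ^ c i))"
        by (simp add: sum_distrib_right)
      also have "\<dots> = (\<Sum>B\<in>Pow A. (-1) ^ card B * (\<Prod>i\<in>U. X i ^ mm B i))"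
      proof (intro sum.cong refl)
        fix B assume "B \<in> Pow A"
        then have B: "finite B" "B \<subseteq> A" using finA finite_subset by auto
        have "(\<Prod>x\<in>B. X (fst (fst x))) = (\<Prod>i\<in>U. X i ^ card {x\<in>B. fst (fst x) = i})"
          using B E U by (intro prod_eq_prod_power_fibres) (auto simp: A_def)
        moreover have "(\<Prod>x\<in>A-B. X (snd (fst x))) = (\<Prod>i\<in>U. X i ^ card {x\<in>A-B. snd (fst x) = i})"
          using finA E U by (intro prod_eq_prod_power_fibres) (auto simp: A_def)
        moreover have "(\<Prod>i\<in>U. X i ^ mm B i) = (\<Prod>i\<in>U. X i ^ card {x\<in>B. fst (fst x) = i})
            * (\<Prod>i\<in>U. X i ^ card {x\<in>A-B. snd (fst x) = i}) * (\<Prod>i\<in>U. X i ^ c i)"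
          by (simp add: mm_def power_add prod.distrib)
        ultimately show "(-1) ^ card B * (\<Prod>x\<in>B. X (fst (fst x))) * (\<Prod>x\<in>A-B. X (snd (fst x))) * (\<Prod>i\<in>U. X i ^ c i)
          = (-1) ^ card B * (\<Prod>i\<in>U. X i ^ mm B i)" by (simp only: mult.assoc)
      qed
      also have "\<dots> = (\<Sum>m\<in>mm ` Pow A. \<Sum>B\<in>{B\<in>Pow A. mm B = m}. (-1) ^ card B * (\<Prod>i\<in>U. X i ^ mm B i))"
        using finA by (intro sum.image_gen) simp
      also have "\<dots> = (\<Sum>m\<in>mm ` Pow A. a m * (\<Prod>i\<in>U. X i ^ m i))"
        unfolding a_def by (intro sum.cong refl) (simp add: sum_distrib_right)
      finally show ?thesis .
    qed
  qed
qed

section \<open>Counting pairs and assigning ranks\<close>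

definition ordered_pairs :: "'i::linorder set \<Rightarrow> ('i \<times> 'i) set" where
  "ordered_pairs I = {(i, j). i \<in> I \<and> j \<in> I \<and> i < j}"

lemma finite_ordered_pairs [simp]: "finite I \<Longrightarrow> finite (ordered_pairs I)"
  by (rule finite_subset[of _ "I \<times> I"]) (auto simp: ordered_pairs_def)

lemma card_ordered_pairs:
  assumes "finite I"
  shows "2 * card (ordered_pairs I) + card I = card I * card I"
  using assms
proof (induction I rule: finite_linorder_max_induct)
  case empty
  then show ?case by (simp add: ordered_pairs_def)
next
  case (insert b A)
  have "ordered_pairs (insert b A) = ordered_pairs A \<union> A \<times> {b}"
    using insert by (force simp: ordered_pairs_def)
  moreover have "card (ordered_pairs A \<union> A \<times> {b}) = card (ordered_pairs A) + card (A \<times> {b})"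
    using insert by (intro card_Un_disjoint) (simp, simp, auto simp: ordered_pairs_def)
  ultimately have "card (ordered_pairs (insert b A)) = card (ordered_pairs A) + card A"
    by (simp add: card_cartesian_product)
  moreover have "b \<notin> A" using insert by auto
  ultimately show ?case using insert by simp
qed

text \<open>Labels are assigned from the largest downwards: the last label goes to an element
  of \<open>I\<close> satisfying the bound for \<open>card I\<close>.\<close>

lemma labelling_exists:
  assumes "finite I" and "\<And>S. S \<subseteq> I \<Longrightarrow> S \<noteq> {} \<Longrightarrow> \<exists>i\<in>S. Q i (card S)"
  shows "\<exists>lab. bij_betw lab I {1..card I} \<and> (\<forall>i\<in>I. Q i (lab i))"
  using assms
proof (induction "card I" arbitrary: I)
  case 0
  then show ?case by (auto simp: bij_betw_def)
next
  case (Suc n)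
  then have "I \<noteq> {}" by auto
  then obtain i where i: "i \<in> I" "Q i (card I)" using Suc.prems by blast
  have n: "n = card (I - {i})" using Suc i by simp
  obtain lab where lab: "bij_betw lab (I - {i}) {1..n}" "\<forall>j\<in>I - {i}. Q j (lab j)"
    using Suc.hyps(1)[OF n] Suc.prems n by (metis Diff_subset finite_Diff subset_trans)
  let ?lab = "lab(i := Suc n)"
  have "bij_betw ?lab (I - {i}) {1..n}" using lab(1) by (subst bij_betw_cong[of _ ?lab lab]) auto
  then have "bij_betw ?lab (insert i (I - {i})) (insert (Suc n) {1..n})"
    using bij_betw_combine[of ?lab "{i}" "{Suc n}" "I - {i}" "{1..n}"] by (auto simp: bij_betw_def)
  moreover have "insert i (I - {i}) = I" "insert (Suc n) {1..n} = {1..card I}" 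
    using i Suc.hyps(2) by auto
  ultimately show ?case using lab(2) i Suc.hyps(2) by (intro exI[of _ ?lab]) auto
qed

section \<open>Bounding the interaction across a cut\<close>

text \<open>In the expanded square each product \<open>w i * w j\<close> is at most the weight with
  the larger label. A given \<open>i\<close> is charged by at most \<open>lab i\<close> indices in
  each of the two orders, whence the factor 2. A squared sum thus becomes a sum over particles,
  which factorises after exponentiation.\<close>

lemma square_sum_le_labelled_sum:
  fixes w :: "'i \<Rightarrow> real" and lab :: "'i \<Rightarrow> nat"
  assumes I: "finite I" and lab: "inj_on lab I" "\<And>i. i \<in> I \<Longrightarrow> 1 \<le> lab i"
    and w: "\<And>i. i \<in> I \<Longrightarrow> 0 \<le> w i \<and> w i \<le> 1"
  shows "(\<Sum>i\<in>I. w i)\<^sup>2 \<le> 2 * (\<Sum>i\<in>I. real (lab i) * w i)"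
proof -
  have half: "(\<Sum>i\<in>I. \<Sum>j\<in>I. if lab j \<le> lab i then w i else 0) \<le> (\<Sum>i\<in>I. real (lab i) * w i)"
  proof (rule sum_mono)
    fix i assume i: "i \<in> I"
    have "card {j\<in>I. lab j \<le> lab i} = card (lab ` {j\<in>I. lab j \<le> lab i})"
      using lab(1) by (intro card_image[symmetric]) (auto intro: inj_on_subset)
    also have "\<dots> \<le> card {1..lab i}" using lab(2) by (intro card_mono) auto
    finally have "real (card {j\<in>I. lab j \<le> lab i}) * w i \<le> real (lab i) * w i"
      using w[OF i] by (intro mult_right_mono) auto
    then show "(\<Sum>j\<in>I. if lab j \<le> lab i then w i else 0) \<le> real (lab i) * w i"
      using I by (simp add: sum.If_cases Int_def)
  qed
  have "(\<Sum>i\<in>I. w i)\<^sup>2 = (\<Sum>i\<in>I. \<Sum>j\<in>I. w i * w j)"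
    by (simp add: power2_eq_square sum_product)
  also have "\<dots> \<le> (\<Sum>i\<in>I. \<Sum>j\<in>I. (if lab j \<le> lab i then w i else 0) + (if lab i \<le> lab j then w j else 0))"
  proof (intro sum_mono)
    fix i j assume "i \<in> I" "j \<in> I"
    then have "w i * w j \<le> w i" "w i * w j \<le> w j" "0 \<le> w i" "0 \<le> w j"
      using w by (auto intro: mult_left_le mult_left_le_one_le)
    then show "w i * w j \<le> (if lab j \<le> lab i then w i else 0) + (if lab i \<le> lab j then w j else 0)"
      by auto
  qed
  also have "\<dots> = (\<Sum>i\<in>I. \<Sum>j\<in>I. if lab j \<le> lab i then w i else 0)
      + (\<Sum>i\<in>I. \<Sum>j\<in>I. if lab i \<le> lab j then w j else 0)"
    by (simp add: sum.distrib)
  also have "(\<Sum>i\<in>I. \<Sum>j\<in>I. if lab i \<le> lab j then w j else 0)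
      = (\<Sum>i\<in>I. \<Sum>j\<in>I. if lab j \<le> lab i then w i else 0)"
    by (rule sum.swap)
  finally show ?thesis using half by linarith
qed

text \<open>At \<open>s\<close> the double sum factorises. The factor over \<open>I\<close> is at
  most \<open>A\<close> because \<open>s\<close> is nonnegative; in the factor over
  \<open>J\<close>, labels up to \<open>s / \<epsilon>\<close> contribute at most 1 each and the
  others are covered by \<open>B\<close>.\<close>

lemma interaction_bound_at_cut:
  fixes u v :: "'i \<Rightarrow> real" and lab :: "'i \<Rightarrow> nat"
  assumes fin: "finite I" "finite J" and lab: "inj_on lab J" "\<And>j. j \<in> J \<Longrightarrow> 1 \<le> lab j"
    and s: "0 \<le> s" "\<And>i. i \<in> I \<Longrightarrow> u i \<le> s" "\<And>j. j \<in> J \<Longrightarrow> s \<le> v j"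
    and pos: "0 < \<epsilon>" "0 < \<eta>" "0 \<le> P"
  shows "P * (\<Sum>i\<in>I. \<Sum>j\<in>J. exp (u i - v j))
    \<le> (P / 2 + P\<^sup>2 / (4 * \<eta> * \<epsilon>\<^sup>2)) * ((\<Sum>i\<in>I. min 1 (exp (\<epsilon> * real (lab i) + u i)))\<^sup>2
        + (\<Sum>j\<in>J. min 1 (exp (\<epsilon> * real (lab j) - v j)))\<^sup>2) + \<eta> * s\<^sup>2"
proof -
  define A where "A = (\<Sum>i\<in>I. min 1 (exp (\<epsilon> * real (lab i) + u i)))"
  define B where "B = (\<Sum>j\<in>J. min 1 (exp (\<epsilon> * real (lab j) - v j)))"
  have A0: "0 \<le> A" and B0: "0 \<le> B" unfolding A_def B_def by (auto intro!: sum_nonneg)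
  have "(\<Sum>i\<in>I. exp (u i - s)) \<le> A" unfolding A_def
  proof (rule sum_mono)
    fix i assume "i \<in> I"
    moreover have "0 \<le> \<epsilon> * real (lab i)" using pos by simp
    ultimately show "exp (u i - s) \<le> min 1 (exp (\<epsilon> * real (lab i) + u i))"
      using s(1,2) by (simp; linarith)
  qed
  moreover have "(\<Sum>j\<in>J. exp (s - v j)) \<le> s / \<epsilon> + B"
  proof -
    have "(\<Sum>j\<in>J. exp (s - v j)) \<le> (\<Sum>j\<in>J. (if real (lab j) \<le> s / \<epsilon> then 1 else 0) + min 1 (exp (\<epsilon> * real (lab j) - v j)))"
    proof (rule sum_mono)
      fix j assume j: "j \<in> J"
      show "exp (s - v j) \<le> (if real (lab j) \<le> s / \<epsilon> then 1 else 0) + min 1 (exp (\<epsilon> * real (lab j) - v j))"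
      proof (cases "real (lab j) \<le> s / \<epsilon>")
        case True
        have "exp (s - v j) \<le> 1" using s(3)[OF j] by simp
        then show ?thesis using True by (simp add: add_increasing2)
      next
        case False
        then have "s \<le> \<epsilon> * real (lab j)" using pos by (simp add: field_simps)
        then show ?thesis using False s(3)[OF j] by simp
      qed
    qed
    also have "\<dots> = real (card {j\<in>J. real (lab j) \<le> s / \<epsilon>}) + B"
      using fin by (simp add: sum.distrib B_def sum.If_cases Int_def)
    also have "real (card {j\<in>J. real (lab j) \<le> s / \<epsilon>}) \<le> s / \<epsilon>"
    proof -
      have "card {j\<in>J. real (lab j) \<le> s / \<epsilon>} = card (lab ` {j\<in>J. real (lab j) \<le> s / \<epsilon>})"
        using lab(1) by (intro card_image[symmetric]) (auto intro: inj_on_subset)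
      \<comment> \<open>Labels are distinct and start at 1, so no more than
        \<open>s / \<epsilon>\<close> of them fit.\<close>
      also have "\<dots> \<le> card {1..nat \<lfloor>s / \<epsilon>\<rfloor>}"
        using lab(2) by (intro card_mono) (auto simp: le_nat_floor)
      finally have "real (card {j\<in>J. real (lab j) \<le> s / \<epsilon>}) \<le> real (nat \<lfloor>s / \<epsilon>\<rfloor>)" by simp
      also have "\<dots> \<le> s / \<epsilon>" using s(1) pos by simp
      finally show ?thesis .
    qed
    finally show ?thesis by simp
  qed
  moreover have "(\<Sum>i\<in>I. \<Sum>j\<in>J. exp (u i - v j)) = (\<Sum>i\<in>I. exp (u i - s)) * (\<Sum>j\<in>J. exp (s - v j))"
    by (simp add: sum_product flip: exp_add)
  ultimately have "(\<Sum>i\<in>I. \<Sum>j\<in>J. exp (u i - v j)) \<le> A * (s / \<epsilon> + B)"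
    using A0 by (auto intro!: mult_mono sum_nonneg)
  then have "P * (\<Sum>i\<in>I. \<Sum>j\<in>J. exp (u i - v j)) \<le> P * (A * (s / \<epsilon> + B))"
    using pos by (intro mult_left_mono)
  also have "\<dots> = P * (A * B) + P * A * s / \<epsilon>" by (simp add: field_simps)
  also have "P * (A * B) \<le> P * ((A\<^sup>2 + B\<^sup>2) / 2)"
    using pos sum_squares_bound[of A B] by (intro mult_left_mono) auto
  \<comment> \<open>Weighted Young inequality, from the square of
    \<open>P * A / \<epsilon> - 2 * \<eta> * s\<close>: the cost in \<open>s\<close> is kept down to
    \<eta> times its square.\<close>
  also have "P * A * s / \<epsilon> \<le> P\<^sup>2 / (4 * \<eta> * \<epsilon>\<^sup>2) * A\<^sup>2 + \<eta> * s\<^sup>2"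
  proof -
    have "0 \<le> (P * A / \<epsilon> - 2 * \<eta> * s)\<^sup>2 / (4 * \<eta>)" using pos by simp
    also have "\<dots> = P\<^sup>2 / (4 * \<eta> * \<epsilon>\<^sup>2) * A\<^sup>2 + \<eta> * s\<^sup>2 - P * A * s / \<epsilon>"
      using pos by (simp add: power2_eq_square field_simps)
    finally show ?thesis by simp
  qed
  also have "P * ((A\<^sup>2 + B\<^sup>2) / 2) + (P\<^sup>2 / (4 * \<eta> * \<epsilon>\<^sup>2) * A\<^sup>2 + \<eta> * s\<^sup>2)
      \<le> (P / 2 + P\<^sup>2 / (4 * \<eta> * \<epsilon>\<^sup>2)) * (A\<^sup>2 + B\<^sup>2) + \<eta> * s\<^sup>2"
    using pos by (simp add: algebra_simps add_divide_distrib)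
  finally show ?thesis unfolding A_def B_def by simp
qed

text \<open>\<open>y\<close> is the signed displacement from the cut, negative on the particle's own
  side. The first term is the interaction charged to rank \<open>r\<close>, small when the particle
  lies well beyond depth \<open>\<epsilon> * r\<close>; the second pays for crossing the
  cut.\<close>

definition site_weight :: "real \<Rightarrow> real \<Rightarrow> real \<Rightarrow> nat \<Rightarrow> real \<Rightarrow> real" where
  "site_weight L \<epsilon> \<eta> r y = exp (L * real r * min 1 (exp (\<epsilon> * real r + y)) + \<eta> * (max 0 y)\<^sup>2)"

text \<open>Cutting at a point \<open>s\<close> costs \<open>\<eta> s\<^sup>2\<close>, which is paid for by the extreme particle on the wrong side
  of the origin.\<close>

lemma interaction_le_site_weights:
  fixes u v :: "'i \<Rightarrow> real" and lab :: "'i \<Rightarrow> nat"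
  assumes fin: "finite I" "finite J" "I \<noteq> {}" "J \<noteq> {}"
    and lab: "inj_on lab I" "inj_on lab J" "\<And>i. i \<in> I \<union> J \<Longrightarrow> 1 \<le> lab i"
    and ord: "\<And>i j. i \<in> I \<Longrightarrow> j \<in> J \<Longrightarrow> u i \<le> v j"
    and pos: "0 < \<epsilon>" "0 < \<eta>" "0 \<le> P" and L: "L = P + P\<^sup>2 / (2 * \<eta> * \<epsilon>\<^sup>2)"
  shows "exp (P * (\<Sum>i\<in>I. \<Sum>j\<in>J. exp (u i - v j)))
    \<le> (\<Prod>i\<in>I. site_weight L \<epsilon> \<eta> (lab i) (u i)) * (\<Prod>j\<in>J. site_weight L \<epsilon> \<eta> (lab j) (- v j))"
proof -
  define a where "a i = min 1 (exp (\<epsilon> * real (lab i) + u i))" for i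
  define b where "b j = min 1 (exp (\<epsilon> * real (lab j) - v j))" for j
  define K where "K = P / 2 + P\<^sup>2 / (4 * \<eta> * \<epsilon>\<^sup>2)"
  have K0: "0 \<le> K" unfolding K_def using pos by simp
  have LK: "L = 2 * K" unfolding L K_def by simp
  define T where "T = Max (u ` I)"
  define S where "S = Min (v ` J)"
  have T: "T \<in> u ` I" "\<And>i. i \<in> I \<Longrightarrow> u i \<le> T" unfolding T_def using fin by auto
  have S: "S \<in> v ` J" "\<And>j. j \<in> J \<Longrightarrow> S \<le> v j" unfolding S_def using fin by auto
  have TS: "T \<le> S" using T(1) S(1) ord by auto
  have sqT: "(max 0 T)\<^sup>2 \<le> (\<Sum>i\<in>I. (max 0 (u i))\<^sup>2)"
    using T(1) member_le_sum[of _ I "\<lambda>i. (max 0 (u i))\<^sup>2"] fin by fastforce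
  have sqS: "(max 0 (- S))\<^sup>2 \<le> (\<Sum>j\<in>J. (max 0 (- v j))\<^sup>2)"
    using S(1) member_le_sum[of _ J "\<lambda>j. (max 0 (- v j))\<^sup>2"] fin by fastforce
  have nonneg: "0 \<le> (\<Sum>i\<in>I. (max 0 (u i))\<^sup>2)" "0 \<le> (\<Sum>j\<in>J. (max 0 (- v j))\<^sup>2)"
    by (auto intro: sum_nonneg)
  have "P * (\<Sum>i\<in>I. \<Sum>j\<in>J. exp (u i - v j)) \<le> K * ((sum a I)\<^sup>2 + (sum b J)\<^sup>2)
      + \<eta> * ((\<Sum>i\<in>I. (max 0 (u i))\<^sup>2) + (\<Sum>j\<in>J. (max 0 (- v j))\<^sup>2))"
  \<comment> \<open>If \<open>S\<close> is nonnegative, the cut is placed at \<open>max 0 T\<close>.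
    Otherwise reflection exchanges the roles of \<open>I\<close> and \<open>J\<close>, and the cut
    is placed at \<open>S\<close>.\<close>
  proof (cases "0 \<le> S")
    case True
    have "P * (\<Sum>i\<in>I. \<Sum>j\<in>J. exp (u i - v j)) \<le> K * ((sum a I)\<^sup>2 + (sum b J)\<^sup>2) + \<eta> * (max 0 T)\<^sup>2"
      unfolding K_def a_def b_def
    proof (rule interaction_bound_at_cut)
      show "u i \<le> max 0 T" if "i \<in> I" for i using T(2)[OF that] by simp
      show "max 0 T \<le> v j" if "j \<in> J" for j using S(2)[OF that] TS True by simp
    qed (use fin lab pos in auto)
    also have "\<eta> * (max 0 T)\<^sup>2 \<le> \<eta> * ((\<Sum>i\<in>I. (max 0 (u i))\<^sup>2) + (\<Sum>j\<in>J. (max 0 (- v j))\<^sup>2))"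
      using sqT nonneg pos by (intro mult_left_mono) auto
    finally show ?thesis by simp
  next
    case False
    have "P * (\<Sum>j\<in>J. \<Sum>i\<in>I. exp (- v j - - u i)) \<le> K * ((sum b J)\<^sup>2 + (\<Sum>i\<in>I. min 1 (exp (\<epsilon> * real (lab i) - - u i)))\<^sup>2) + \<eta> * (max 0 (- S))\<^sup>2"
      unfolding K_def b_def diff_conv_add_uminus[of _ "v _"]
    proof (rule interaction_bound_at_cut)
      show "- v j \<le> max 0 (- S)" if "j \<in> J" for j using S(2)[OF that] by simp
      show "max 0 (- S) \<le> - u i" if "i \<in> I" for i using T(2)[OF that] TS False by simp
    qed (use fin lab pos in auto)
    moreover have "(\<Sum>i\<in>I. min 1 (exp (\<epsilon> * real (lab i) - - u i))) = sum a I" by (simp add: a_def)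
    moreover have "(\<Sum>j\<in>J. \<Sum>i\<in>I. exp (- v j - - u i)) = (\<Sum>i\<in>I. \<Sum>j\<in>J. exp (u i - v j))"
      by (subst sum.swap) simp
    ultimately have "P * (\<Sum>i\<in>I. \<Sum>j\<in>J. exp (u i - v j)) \<le> K * ((sum a I)\<^sup>2 + (sum b J)\<^sup>2) + \<eta> * (max 0 (- S))\<^sup>2"
      by (simp add: add.commute)
    also have "\<eta> * (max 0 (- S))\<^sup>2 \<le> \<eta> * ((\<Sum>i\<in>I. (max 0 (u i))\<^sup>2) + (\<Sum>j\<in>J. (max 0 (- v j))\<^sup>2))"
      using sqS nonneg pos by (intro mult_left_mono) auto
    finally show ?thesis by simp
  qed
  \<comment> \<open>The squares are linearised rank by rank; the resulting factor 2 turns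
    \<open>K\<close> into \<open>L\<close>.\<close>
  also have "K * ((sum a I)\<^sup>2 + (sum b J)\<^sup>2)
      \<le> K * (2 * (\<Sum>i\<in>I. real (lab i) * a i) + 2 * (\<Sum>j\<in>J. real (lab j) * b j))"
    using K0 fin lab by (intro mult_left_mono add_mono square_sum_le_labelled_sum) (auto simp: a_def b_def)
  also have "\<dots> + \<eta> * ((\<Sum>i\<in>I. (max 0 (u i))\<^sup>2) + (\<Sum>j\<in>J. (max 0 (- v j))\<^sup>2))
      = (\<Sum>i\<in>I. L * real (lab i) * a i + \<eta> * (max 0 (u i))\<^sup>2) + (\<Sum>j\<in>J. L * real (lab j) * b j + \<eta> * (max 0 (- v j))\<^sup>2)"
    by (simp add: LK sum.distrib sum_distrib_left algebra_simps)
  finally show ?thesis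
    by (simp add: site_weight_def a_def b_def flip: exp_sum[OF fin(1)] exp_sum[OF fin(2)] exp_add)
qed

section \<open>Gaussian estimates\<close>

lemma nn_integral_gaussian:
  assumes "a > 0"
  shows "(\<integral>\<^sup>+y. ennreal (exp (- (y\<^sup>2) / a)) \<partial>lborel) = ennreal (sqrt (pi * a))"
proof -
  let ?\<sigma> = "sqrt (a / 2)"
  have eq: "exp (- (y\<^sup>2) / a) = sqrt (pi * a) * normal_density 0 ?\<sigma> y" for y
    using assms by (simp add: normal_density_def)
  have "(\<integral>\<^sup>+y. ennreal (exp (- (y\<^sup>2) / a)) \<partial>lborel)
      = ennreal (\<integral>y. sqrt (pi * a) * normal_density 0 ?\<sigma> y \<partial>lborel)"
    unfolding eq using assms by (intro nn_integral_eq_integral) auto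
  then show ?thesis using assms by simp
qed

text \<open>Substituting \<open>t = \<nu> + \<sigma> * y\<close>, and using that the Gaussian is
  even, reduces both sides of the cut to one form, in which positive \<open>y\<close> is a
  fluctuation towards the wrong side.\<close>

lemma nn_integral_shifted_gaussian:
  fixes \<phi> :: "real \<Rightarrow> ennreal"
  assumes [measurable]: "\<phi> \<in> borel_measurable borel" and \<sigma>: "\<sigma> = 1 \<or> \<sigma> = -1"
  shows "(\<integral>\<^sup>+t. ennreal (exp (- ((t - \<nu>)\<^sup>2) / a)) * \<phi> (\<sigma> * t) \<partial>lborel)
    = (\<integral>\<^sup>+y. ennreal (exp (- (y\<^sup>2) / a)) * \<phi> (\<sigma> * \<nu> + y) \<partial>lborel)"
  using \<sigma>
proof
  assume s: "\<sigma> = 1"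
  show ?thesis
    by (subst nn_integral_real_affine[where c=1 and t=\<nu>]) (auto simp: s)
next
  assume s: "\<sigma> = -1"
  show ?thesis
    by (subst nn_integral_real_affine[where c="-1" and t=\<nu>]) (auto simp: s)
qed

text \<open>A bound for the logarithm of the excess mass at rank \<open>r\<close>: the first term
  comes from fluctuations up to \<open>\<epsilon> * r / 2\<close>, the second from larger ones. The
  factor \<open>sqrt 2\<close> is the cost of a Gaussian of doubled variance.\<close>

definition site_error :: "real \<Rightarrow> real \<Rightarrow> real \<Rightarrow> nat \<Rightarrow> real" where
  "site_error L \<epsilon> a r = L * real r * exp (- (\<epsilon> * real r / 2))
     + sqrt 2 * exp (L * real r - \<epsilon>\<^sup>2 * (real r)\<^sup>2 / (16 * a))"

text \<open>Small fluctuations keep the particle deep on its own side, with no quadratic penalty and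
  an exponentially small charge. For larger ones the Gaussian exponent \<open>y^2 / a\<close> is
  divided up: a quarter absorbs the penalty, a quarter yields the decay in \<open>r\<close>, and
  half remains for the integration.\<close>

lemma gaussian_site_weight_le:
  assumes a: "a > 0" and \<epsilon>: "\<epsilon> > 0" and L: "L \<ge> 0" and \<sigma>: "\<sigma> = 1 \<or> \<sigma> = -1"
    and \<nu>: "\<sigma> * \<nu> \<le> - (2 * \<epsilon> * real r)"
  shows "(\<integral>\<^sup>+t. ennreal (exp (- ((t - \<nu>)\<^sup>2) / a)) * ennreal (site_weight L \<epsilon> (1 / (4 * a)) r (\<sigma> * t)) \<partial>lborel)
    \<le> ennreal (exp (site_error L \<epsilon> a r)) * ennreal (sqrt (pi * a))"
proof -
  define A where "A = L * real r * exp (- (\<epsilon> * real r / 2))"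
  define B where "B = L * real r - \<epsilon>\<^sup>2 * (real r)\<^sup>2 / (16 * a)"
  have A0: "0 \<le> A" using L by (simp add: A_def)
  have [measurable]: "(\<lambda>y. ennreal (site_weight L \<epsilon> (1 / (4 * a)) r y)) \<in> borel_measurable borel"
    unfolding site_weight_def by measurable
  have pw: "exp (- (y\<^sup>2) / a) * site_weight L \<epsilon> (1 / (4 * a)) r (\<sigma> * \<nu> + y)
      \<le> exp A * exp (- (y\<^sup>2) / a) + exp B * exp (- (y\<^sup>2) / (2 * a))" for y
  proof (cases "y \<le> \<epsilon> * real r / 2")
    case True
    have er: "0 \<le> \<epsilon> * real r" using \<epsilon> by simp
    have "max 0 (\<sigma> * \<nu> + y) = 0" using True \<nu> er by simp
    moreover have "min 1 (exp (\<epsilon> * real r + (\<sigma> * \<nu> + y))) \<le> exp (- (\<epsilon> * real r / 2))"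
      using True \<nu> by (intro min.coboundedI2) simp
    then have "L * real r * min 1 (exp (\<epsilon> * real r + (\<sigma> * \<nu> + y))) \<le> A"
      unfolding A_def using L by (intro mult_left_mono) auto
    ultimately have "site_weight L \<epsilon> (1 / (4 * a)) r (\<sigma> * \<nu> + y) \<le> exp A"
      by (simp add: site_weight_def)
    then have "exp (- (y\<^sup>2) / a) * site_weight L \<epsilon> (1 / (4 * a)) r (\<sigma> * \<nu> + y) \<le> exp (- (y\<^sup>2) / a) * exp A"
      by (intro mult_left_mono) auto
    then show ?thesis by (simp add: mult.commute add_increasing2)
  next
    case False
    have er: "0 \<le> \<epsilon> * real r" using \<epsilon> by simp
    have "(max 0 (\<sigma> * \<nu> + y))\<^sup>2 \<le> y\<^sup>2"
      using False \<nu> er by (intro power_mono) auto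
    then have 1: "1 / (4 * a) * (max 0 (\<sigma> * \<nu> + y))\<^sup>2 \<le> 1 / (4 * a) * y\<^sup>2"
      using a by (intro mult_left_mono) auto
    have 2: "L * real r * min 1 (exp (\<epsilon> * real r + (\<sigma> * \<nu> + y))) \<le> L * real r"
      using L by (intro mult_left_le) auto
    have "(\<epsilon> * real r / 2)\<^sup>2 \<le> y\<^sup>2" using False er by (intro power_mono) auto
    then have 3: "\<epsilon>\<^sup>2 * (real r)\<^sup>2 / (16 * a) \<le> y\<^sup>2 / (4 * a)"
      using a by (simp add: field_simps power2_eq_square)
    have "- (y\<^sup>2) / a + (L * real r * min 1 (exp (\<epsilon> * real r + (\<sigma> * \<nu> + y))) + 1 / (4 * a) * (max 0 (\<sigma> * \<nu> + y))\<^sup>2)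
       \<le> - (y\<^sup>2) / a + (L * real r + 1 / (4 * a) * y\<^sup>2)" using 1 2 by linarith
    also have "\<dots> = L * real r - y\<^sup>2 / (4 * a) + - (y\<^sup>2) / (2 * a)" using a by (simp add: field_simps)
    also have "\<dots> \<le> B + - (y\<^sup>2) / (2 * a)" unfolding B_def using 3 by linarith
    finally have "exp (- (y\<^sup>2) / a) * site_weight L \<epsilon> (1 / (4 * a)) r (\<sigma> * \<nu> + y) \<le> exp B * exp (- (y\<^sup>2) / (2 * a))"
      unfolding site_weight_def by (simp flip: exp_add)
    then show ?thesis by (simp add: add_increasing)
  qed
  have "(\<integral>\<^sup>+t. ennreal (exp (- ((t - \<nu>)\<^sup>2) / a)) * ennreal (site_weight L \<epsilon> (1 / (4 * a)) r (\<sigma> * t)) \<partial>lborel)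
    = (\<integral>\<^sup>+y. ennreal (exp (- (y\<^sup>2) / a)) * ennreal (site_weight L \<epsilon> (1 / (4 * a)) r (\<sigma> * \<nu> + y)) \<partial>lborel)"
    by (rule nn_integral_shifted_gaussian[OF _ \<sigma>]) measurable
  also have "\<dots> \<le> (\<integral>\<^sup>+y. ennreal (exp A) * ennreal (exp (- (y\<^sup>2) / a)) + ennreal (exp B) * ennreal (exp (- (y\<^sup>2) / (2 * a))) \<partial>lborel)"
    using pw by (intro nn_integral_mono) (simp add: site_weight_def flip: ennreal_mult' ennreal_plus)
  also have "\<dots> = ennreal (exp A) * ennreal (sqrt (pi * a)) + ennreal (exp B) * ennreal (sqrt (pi * (2 * a)))"
    using a by (subst nn_integral_add) (auto simp: nn_integral_cmult nn_integral_gaussian[simplified])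
  also have "\<dots> = ennreal ((exp A + sqrt 2 * exp B) * sqrt (pi * a))"
    using a by (simp add: real_sqrt_mult algebra_simps flip: ennreal_mult' ennreal_plus)
  also have "\<dots> \<le> ennreal (exp (site_error L \<epsilon> a r) * sqrt (pi * a))"
  proof (intro ennreal_leI mult_right_mono)
    \<comment> \<open>As \<open>A\<close> is nonnegative, \<open>exp A\<close> can be factored out,
      after which \<open>1 + t \<le> exp t\<close> merges both contributions into a single
      exponential.\<close>
    have "sqrt 2 * exp B \<le> exp A * (sqrt 2 * exp B)" using A0 mult_right_mono[of 1 "exp A" "sqrt 2 * exp B"] by simp
    then have "exp A + sqrt 2 * exp B \<le> exp A * (1 + sqrt 2 * exp B)" by (simp add: algebra_simps)
    also have "\<dots> \<le> exp A * exp (sqrt 2 * exp B)" by (intro mult_left_mono exp_ge_add_one_self) auto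
    finally show "exp A + sqrt 2 * exp B \<le> exp (site_error L \<epsilon> a r)"
      by (simp add: site_error_def A_def B_def exp_add)
  qed (use a in simp)
  finally show ?thesis using a by (simp add: ennreal_mult)
qed

text \<open>For nonnegative \<open>y\<close> the square of \<open>\<tau> + y\<close> is at least the
  sum of the squares, so the mass beyond \<tau> is at most the fraction \<open>x / 2\<close>, with
  \<open>x\<close> as in the proof. Writing the bound as \<open>exp (- x)\<close> turns a product
  over particles into a convergent sum.\<close>

lemma gaussian_half_line_ge:
  assumes a: "a > 0" and \<tau>: "0 \<le> \<tau>" and \<sigma>: "\<sigma> = 1 \<or> \<sigma> = -1" and \<nu>: "\<sigma> * \<nu> \<le> - \<tau>"
  shows "ennreal (exp (- exp (- (\<tau>\<^sup>2) / a))) * ennreal (sqrt (pi * a))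
    \<le> (\<integral>\<^sup>+t. ennreal (exp (- ((t - \<nu>)\<^sup>2) / a)) * indicator {..<0} (\<sigma> * t) \<partial>lborel)"
proof -
  define G where "G y = ennreal (exp (- (y\<^sup>2) / a))" for y :: real
  have [measurable]: "G \<in> borel_measurable borel" unfolding G_def by measurable
  define g where "g = sqrt (pi * a)"
  define x where "x = exp (- (\<tau>\<^sup>2) / a)"
  have x: "0 < x" "x \<le> 1" using a by (auto simp: x_def)
  have g0: "0 \<le> g" using a by (simp add: g_def)
  have Gg: "(\<integral>\<^sup>+y. G y \<partial>lborel) = ennreal g"
    unfolding G_def g_def using nn_integral_gaussian[OF a] by simp
  define H where "H = (\<integral>\<^sup>+y. G y * indicator {0..} y \<partial>lborel)"
  have "H + H = ennreal g"
  proof -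
    have "H = (\<integral>\<^sup>+y. G y * indicator {..0} y \<partial>lborel)"
      unfolding H_def by (subst nn_integral_real_affine[where c="-1" and t=0])
        (auto simp: G_def indicator_def)
    then have "H + H = (\<integral>\<^sup>+y. G y * indicator {0..} y + G y * indicator {..0} y \<partial>lborel)"
      by (subst nn_integral_add) (auto simp: H_def)
    also have "\<dots> = (\<integral>\<^sup>+y. G y \<partial>lborel)"
    proof (rule nn_integral_cong_AE)
      show "AE y in lborel. G y * indicator {0..} y + G y * indicator {..0} y = G y"
        using AE_lborel_singleton[of "0::real"] by eventually_elim (auto simp: indicator_def)
    qed
    finally show ?thesis using Gg by simp
  qed
  then have "H \<le> ennreal (g / 2)"
  proof (cases H rule: ennreal_cases)
    case (real h)
    then show ?thesis using \<open>H + H = ennreal g\<close> g0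
      by (simp flip: ennreal_plus)
  qed auto
  have "(\<integral>\<^sup>+y. G y * indicator {\<tau>..} y \<partial>lborel) = (\<integral>\<^sup>+y. G (\<tau> + y) * indicator {0..} y \<partial>lborel)"
    by (subst nn_integral_real_affine[where c=1 and t=\<tau>]) (auto simp: indicator_def)
  also have "\<dots> \<le> (\<integral>\<^sup>+y. ennreal x * (G y * indicator {0..} y) \<partial>lborel)"
  proof (rule nn_integral_mono)
    fix y :: real
    show "G (\<tau> + y) * indicator {0..} y \<le> ennreal x * (G y * indicator {0..} y)"
    proof (cases "0 \<le> y")
      case True
      have "\<tau>\<^sup>2 + y\<^sup>2 \<le> (\<tau> + y)\<^sup>2" using True \<tau> by (simp add: power2_sum)
      then have "- ((\<tau> + y)\<^sup>2) / a \<le> - (\<tau>\<^sup>2) / a + - (y\<^sup>2) / a"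
        using a by (simp add: field_simps)
      then have "exp (- ((\<tau> + y)\<^sup>2) / a) \<le> x * exp (- (y\<^sup>2) / a)"
        unfolding x_def by (simp flip: exp_add)
      then show ?thesis using True x by (simp add: G_def flip: ennreal_mult')
    qed simp
  qed
  also have "\<dots> = ennreal x * H" unfolding H_def by (rule nn_integral_cmult) measurable
  also have "\<dots> \<le> ennreal x * ennreal (g / 2)" using \<open>H \<le> _\<close> by (intro mult_left_mono) auto
  finally have tail: "(\<integral>\<^sup>+y. G y * indicator {\<tau>..} y \<partial>lborel) \<le> ennreal (x * g / 2)"
    using x by (simp flip: ennreal_mult')
  have "ennreal g = (\<integral>\<^sup>+y. G y * indicator {..<\<tau>} y + G y * indicator {\<tau>..} y \<partial>lborel)"
    unfolding Gg[symmetric] by (intro nn_integral_cong) (auto simp: indicator_def)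
  also have "\<dots> = (\<integral>\<^sup>+y. G y * indicator {..<\<tau>} y \<partial>lborel) + (\<integral>\<^sup>+y. G y * indicator {\<tau>..} y \<partial>lborel)"
    by (intro nn_integral_add) auto
  also have "\<dots> \<le> (\<integral>\<^sup>+y. G y * indicator {..<\<tau>} y \<partial>lborel) + ennreal (x * g / 2)"
    using tail by (intro add_left_mono)
  finally have "ennreal g - ennreal (x * g / 2) \<le> (\<integral>\<^sup>+y. G y * indicator {..<\<tau>} y \<partial>lborel)"
    by (simp add: ennreal_minus_le_iff add.commute)
  moreover have "ennreal (exp (- x) * g) \<le> ennreal g - ennreal (x * g / 2)"
  proof -
    \<comment> \<open>For \<open>x\<close> in the unit interval, \<open>1 - x / 2\<close> lies above
      \<open>1 / (1 + x)\<close>, hence above \<open>exp (- x)\<close>.\<close>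
    have "exp (- x) \<le> 1 / (1 + x)"
      using exp_ge_add_one_self[of x] x by (simp add: exp_minus field_simps)
    also have "1 / (1 + x) \<le> 1 - x / 2"
      using x mult_left_mono[of x 1 x] by (simp add: field_simps)
    finally have "exp (- x) * g \<le> (1 - x / 2) * g" using g0 by (rule mult_right_mono)
    then show ?thesis using x g0 by (subst ennreal_minus) (auto simp: algebra_simps intro!: ennreal_leI)
  qed
  moreover have "(\<integral>\<^sup>+y. G y * indicator {..<\<tau>} y \<partial>lborel) \<le> (\<integral>\<^sup>+y. G y * indicator {..<0} (\<sigma> * \<nu> + y) \<partial>lborel)"
    using \<nu> by (intro nn_integral_mono) (auto simp: indicator_def)
  moreover have "(\<integral>\<^sup>+y. G y * indicator {..<0} (\<sigma> * \<nu> + y) \<partial>lborel)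
      = (\<integral>\<^sup>+t. ennreal (exp (- ((t - \<nu>)\<^sup>2) / a)) * indicator {..<0} (\<sigma> * t) \<partial>lborel)"
    unfolding G_def by (rule nn_integral_shifted_gaussian[symmetric, OF _ \<sigma>]) measurable
  ultimately have "ennreal (exp (- x) * g)
    \<le> (\<integral>\<^sup>+t. ennreal (exp (- ((t - \<nu>)\<^sup>2) / a)) * indicator {..<0} (\<sigma> * t) \<partial>lborel)" by simp
  then show ?thesis using g0 by (simp add: x_def g_def ennreal_mult)
qed

lemma summable_site_error:
  assumes "a > 0" "\<epsilon> > 0"
  shows "summable (site_error L \<epsilon> a)"
proof (rule summable_comparison_test_bigo)
  show "summable (\<lambda>n. norm (1 / real n ^ 2))"
    using inverse_power_summable[of 2, where 'a=real] by (simp add: field_simps)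
  have "(\<lambda>n. exp (L * real n - c * (real n)\<^sup>2)) \<in> O(\<lambda>n. 1 / real n ^ 2)" if "c > 0" for c :: real
    using that by real_asymp
  from this[of "\<epsilon>\<^sup>2 / (16 * a)"]
  have "(\<lambda>n. exp (L * real n - \<epsilon>\<^sup>2 * (real n)\<^sup>2 / (16 * a))) \<in> O(\<lambda>n. 1 / real n ^ 2)"
    using assms by simp
  moreover have "(\<lambda>n. L * real n * exp (- (\<epsilon> * real n / 2))) \<in> O(\<lambda>n. 1 / real n ^ 2)"
    using assms by real_asymp
  ultimately show "site_error L \<epsilon> a \<in> O(\<lambda>n. 1 / real n ^ 2)"
    unfolding site_error_def[abs_def] by (intro sum_in_bigo landau_o.big.cmult_in_iff[THEN iffD2]) auto
qed

lemma summable_gaussian_tail: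
  assumes "a > 0" "\<epsilon> > 0"
  shows "summable (\<lambda>r. exp (- ((2 * \<epsilon> * real r)\<^sup>2) / a))"
proof (rule summable_comparison_test_bigo)
  show "summable (\<lambda>n. norm (1 / real n ^ 2))"
    using inverse_power_summable[of 2, where 'a=real] by (simp add: field_simps)
  show "(\<lambda>r. exp (- ((2 * \<epsilon> * real r)\<^sup>2) / a)) \<in> O(\<lambda>n. 1 / real n ^ 2)"
    using assms by real_asymp
qed

section \<open>Splitting the Laughlin weight\<close>

lemma laughlin_Psi_norm_square:
  "ennreal ((cmod (laughlin_Psi p R l N z))\<^sup>2)
    = ennreal ((cmod (\<Prod>e\<in>ordered_pairs {..<N}. (exp (z (snd e) / of_real R) - exp (z (fst e) / of_real R)) ^ p))\<^sup>2)
      * (\<Prod>i<N. ennreal (exp (- ((Re (z i))\<^sup>2) / l\<^sup>2)))"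
proof -
  let ?f = "\<lambda>j k. (exp (z k / of_real R) - exp (z j / of_real R)) ^ p"
  have "(\<Prod>k<N. \<Prod>j<k. ?f j k) = (\<Prod>(k, j)\<in>Sigma {..<N} (\<lambda>k. {..<k}). ?f j k)"
    by (subst prod.Sigma) auto
  also have "\<dots> = (\<Prod>e\<in>ordered_pairs {..<N}. ?f (fst e) (snd e))"
    by (rule prod.reindex_bij_witness[of _ "\<lambda>(i, j). (j, i)" "\<lambda>(i, j). (j, i)"])
       (auto simp: ordered_pairs_def)
  finally have 1: "(\<Prod>k<N. \<Prod>j<k. ?f j k) = (\<Prod>e\<in>ordered_pairs {..<N}. ?f (fst e) (snd e))" .
  have 2: "(exp (- (1 / (2 * l\<^sup>2)) * (\<Sum>k<N. (Re (z k))\<^sup>2)))\<^sup>2 = (\<Prod>i<N. exp (- ((Re (z i))\<^sup>2) / l\<^sup>2))"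
  proof -
    have "2 * (- (1 / (2 * l\<^sup>2)) * (\<Sum>k<N. (Re (z k))\<^sup>2)) = (\<Sum>i<N. - ((Re (z i))\<^sup>2) / l\<^sup>2)"
      by (simp add: sum_negf flip: sum_divide_distrib)
    then show ?thesis by (simp only: exp_sum[OF finite_lessThan, symmetric] exp_double[symmetric])
  qed
  show ?thesis
    unfolding laughlin_Psi_def 1
    by (simp only: norm_mult power_mult_distrib norm_of_real abs_exp_cancel 2)
       (simp add: ennreal_mult prod_nonneg prod_ennreal)
qed

text \<open>The smallest values are picked one at a time. Ties leave the choice open, but existence
  suffices to cover all configurations by ordered ones.\<close>

lemma ordered_initial_subset_exists:
  fixes f :: "'i \<Rightarrow> real"
  assumes "finite U" "k \<le> card U"
  shows "\<exists>I\<subseteq>U. card I = k \<and> (\<forall>i\<in>I. \<forall>j\<in>U - I. f i \<le> f j)"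
  using assms(2)
proof (induction k)
  case 0
  then show ?case by (intro exI[of _ "{}"]) auto
next
  case (Suc k)
  then obtain I where I: "I \<subseteq> U" "card I = k" "\<forall>i\<in>I. \<forall>j\<in>U - I. f i \<le> f j" by auto
  then have "U - I \<noteq> {}" using Suc.prems
    by (metis Diff_eq_empty_iff Suc_n_not_le_n subset_antisym)
  then have "\<exists>x\<in>U - I. \<forall>y\<in>U - I. f x \<le> f y"
    using arg_min_if_finite[of "U - I" f] assms(1) by (metis finite_Diff not_le)
  then obtain x where x: "x \<in> U - I" "\<forall>y\<in>U - I. f x \<le> f y" by blast
  then show ?case using I finite_subset[OF I(1) assms(1)]
    by (intro exI[of _ "insert x I"]) auto
qed

section \<open>A fixed split of the particles: comparing the full polynomial with
  \<open>G\<close>\<close>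

locale laughlin_cut =
  fixes p N k :: nat and R l :: real and I :: "nat set"
  assumes p: "1 \<le> p" and R: "0 < R" and l: "0 < l"
    and I: "I \<subseteq> {..<N}" "card I = k" and k: "1 \<le> k" "k < N"
begin

abbreviation "U \<equiv> {..<N}"
definition "J = U - I"
definition "a = (l / R)\<^sup>2"
text \<open>The cut in the rescaled coordinate \<open>Re z / R\<close>.\<close>

definition "b = (real k - 1 / 2) * real p * a"
text \<open>Chosen so that \<open>2 * \<epsilon> * r\<close> is \<open>r p a / 2\<close>, the depth
  guaranteed to the Gaussian centre of rank \<open>r\<close>.\<close>

definition "\<epsilon> = real p * a / 4"
definition "\<sigma> i = (if i \<in> I then 1 else - 1 :: real)"
text \<open>The constant of the interaction bound for strength \<open>P = 2 * p\<close>, the 2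
  coming from the squared modulus, and penalty \<open>\<eta> = 1 / (4 * a)\<close>, a quarter of the
  Gaussian exponent.\<close>

definition "L = 2 * real p + (2 * real p)\<^sup>2 / (2 * (1 / (4 * a)) * \<epsilon>\<^sup>2)"
abbreviation "\<mu> \<equiv> config_measure R N"
definition "E = ordered_pairs I \<union> ordered_pairs J"
definition "c i = (if i \<in> J then p * k else 0)"
definition X :: "(nat \<Rightarrow> complex) \<Rightarrow> nat \<Rightarrow> complex" where "X z i = exp (z i / of_real R)"
definition edge_prod :: "(nat \<times> nat) set \<Rightarrow> (nat \<Rightarrow> complex) \<Rightarrow> complex"
  where "edge_prod F x = (\<Prod>e\<in>F. (x (snd e) - x (fst e)) ^ p)"
definition G :: "(nat \<Rightarrow> complex) \<Rightarrow> complex" where "G x = edge_prod E x * (\<Prod>i\<in>U. x i ^ c i)"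
definition "gauss z = (\<Prod>i\<in>U. ennreal (exp (- ((Re (z i))\<^sup>2) / l\<^sup>2)))" for z :: "nat \<Rightarrow> complex"

lemma sigma: "\<sigma> i = 1 \<or> \<sigma> i = - 1"
  by (simp add: \<sigma>_def)

lemma fin: "finite I" "finite J" "finite E"
proof -
  show I': "finite I" using I(1) by (rule finite_subset) simp
  show J': "finite J" by (simp add: J_def)
  show "finite E" using I' J' by (simp add: E_def)
qed

lemma IJ: "I \<union> J = U" "I \<inter> J = {}" "card J = N - k" "I \<noteq> {}" "J \<noteq> {}" "J \<subseteq> U"
proof -
  show "card J = N - k" unfolding J_def using I fin(1) by (simp add: card_Diff_subset)
  then show "J \<noteq> {}" using k by auto
  show "I \<noteq> {}" using I k by auto
qed (use I in \<open>auto simp: J_def\<close>)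

lemma a_pos: "0 < a" and eps_pos: "0 < \<epsilon>"
  using p R l by (auto simp: a_def \<epsilon>_def)

lemma L_nonneg: "0 \<le> L" using a_pos by (simp add: L_def)

text \<open>The modulus ignores the orientation of a pair, so the pairs that cross between the
  groups can be indexed by \<open>I \<times> J\<close> regardless of which index is smaller.\<close>

lemma edge_prod_split:
  "cmod (edge_prod (ordered_pairs U) x) = cmod (edge_prod E x) * (\<Prod>i\<in>I. \<Prod>j\<in>J. cmod (x j - x i) ^ p)"
proof -
  define C where "C = {e\<in>ordered_pairs U. fst e \<in> I \<longleftrightarrow> snd e \<notin> I}"
  have EC: "ordered_pairs U = E \<union> C" "E \<inter> C = {}"
    using I(1) unfolding E_def C_def ordered_pairs_def J_def by auto
  have C: "finite C" unfolding C_def by simp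
  have "cmod (edge_prod (ordered_pairs U) x) = (\<Prod>e\<in>E \<union> C. cmod (x (snd e) - x (fst e)) ^ p)"
    unfolding edge_prod_def EC(1) by (simp add: norm_power flip: prod_norm)
  also have "\<dots> = (\<Prod>e\<in>E. cmod (x (snd e) - x (fst e)) ^ p) * (\<Prod>e\<in>C. cmod (x (snd e) - x (fst e)) ^ p)"
    by (rule prod.union_disjoint[OF fin(3) C EC(2)])
  also have "(\<Prod>e\<in>E. cmod (x (snd e) - x (fst e)) ^ p) = cmod (edge_prod E x)"
    unfolding edge_prod_def by (simp add: norm_power flip: prod_norm)
  also have "(\<Prod>e\<in>C. cmod (x (snd e) - x (fst e)) ^ p) = (\<Prod>e\<in>I \<times> J. cmod (x (snd e) - x (fst e)) ^ p)"
    by (rule prod.reindex_bij_witness[of _ "\<lambda>(i, j). if i < j then (i, j) else (j, i)"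
          "\<lambda>(i, j). if i \<in> I then (i, j) else (j, i)"])
       (use I(1) in \<open>auto simp: C_def ordered_pairs_def J_def norm_minus_commute not_less le_less split: if_splits\<close>)
  also have "\<dots> = (\<Prod>i\<in>I. \<Prod>j\<in>J. cmod (x j - x i) ^ p)"
    by (simp add: prod.cartesian_product split_def)
  finally show ?thesis .
qed

text \<open>The exponent \<open>p * k\<close> spreads over the \<open>k\<close> elements of
  \<open>I\<close>: each crossing pair receives \<open>f j ^ p\<close>, which is its factor with the
  variable from \<open>I\<close> set to 0.\<close>

lemma prod_c: "(\<Prod>i\<in>U. f i ^ c i) = (\<Prod>i\<in>I. \<Prod>j\<in>J. f j ^ p)" for f :: "nat \<Rightarrow> 'c::comm_semiring_1"
proof -
  have "(\<Prod>i\<in>U. f i ^ c i) = (\<Prod>j\<in>J. f j ^ (p * k))"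
    by (rule prod.mono_neutral_cong_right) (auto simp: c_def J_def)
  also have "\<dots> = (\<Prod>j\<in>J. f j ^ p) ^ k"
    by (simp add: power_mult prod_power_distrib)
  finally show ?thesis by (simp add: I(2))
qed

text \<open>A crossing factor \<open>|x j - x i|\<close> is at most
  \<open>|x j| * (1 + |x i| / |x j|)\<close>, and \<open>1 + t \<le> exp t\<close>.\<close>

lemma edge_prod_le_G:
  assumes "\<And>i. i \<in> U \<Longrightarrow> x i \<noteq> 0"
  shows "(cmod (edge_prod (ordered_pairs U) x))\<^sup>2
    \<le> (cmod (G x))\<^sup>2 * exp (2 * real p * (\<Sum>i\<in>I. \<Sum>j\<in>J. cmod (x i) / cmod (x j)))"
proof -
  have factor: "cmod (x j - x i) ^ p \<le> cmod (x j) ^ p * exp (real p * (cmod (x i) / cmod (x j)))"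
    if "i \<in> I" "j \<in> J" for i j
  proof -
    have pos: "cmod (x j) > 0" using that assms by (auto simp: J_def)
    have "cmod (x j - x i) \<le> cmod (x j) + cmod (x i)" by (rule norm_triangle_ineq4)
    also have "\<dots> = cmod (x j) * (1 + cmod (x i) / cmod (x j))" using pos by (simp add: field_simps)
    also have "\<dots> \<le> cmod (x j) * exp (cmod (x i) / cmod (x j))"
      by (intro mult_left_mono exp_ge_add_one_self) auto
    finally have "cmod (x j - x i) ^ p \<le> (cmod (x j) * exp (cmod (x i) / cmod (x j))) ^ p"
      by (intro power_mono) auto
    then show ?thesis by (simp only: power_mult_distrib exp_of_nat_mult)
  qed
  have "(\<Prod>i\<in>I. \<Prod>j\<in>J. cmod (x j - x i) ^ p)
      \<le> (\<Prod>i\<in>I. \<Prod>j\<in>J. cmod (x j) ^ p * exp (real p * (cmod (x i) / cmod (x j))))"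
  proof (rule prod_mono, rule conjI)
    fix i assume "i \<in> I"
    then show "(\<Prod>j\<in>J. cmod (x j - x i) ^ p) \<le> (\<Prod>j\<in>J. cmod (x j) ^ p * exp (real p * (cmod (x i) / cmod (x j))))"
      using factor by (intro prod_mono) simp
  qed (simp add: prod_nonneg)
  also have "\<dots> = (\<Prod>i\<in>U. cmod (x i) ^ c i) * exp (real p * (\<Sum>i\<in>I. \<Sum>j\<in>J. cmod (x i) / cmod (x j)))"
    using fin by (simp add: prod.distrib prod_c exp_sum sum_distrib_left)
  finally have "cmod (edge_prod (ordered_pairs U) x)
      \<le> cmod (edge_prod E x) * ((\<Prod>i\<in>U. cmod (x i) ^ c i) * exp (real p * (\<Sum>i\<in>I. \<Sum>j\<in>J. cmod (x i) / cmod (x j))))"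
    unfolding edge_prod_split by (rule mult_left_mono) simp
  also have "\<dots> = cmod (G x) * exp (real p * (\<Sum>i\<in>I. \<Sum>j\<in>J. cmod (x i) / cmod (x j)))"
    by (simp add: G_def norm_mult norm_power flip: prod_norm)
  finally have "(cmod (edge_prod (ordered_pairs U) x))\<^sup>2
    \<le> (cmod (G x) * exp (real p * (\<Sum>i\<in>I. \<Sum>j\<in>J. cmod (x i) / cmod (x j))))\<^sup>2"
    by (intro power_mono) auto
  also have "\<dots> = (cmod (G x))\<^sup>2 * exp (2 * real p * (\<Sum>i\<in>I. \<Sum>j\<in>J. cmod (x i) / cmod (x j)))"
    by (simp add: power_mult_distrib mult.assoc flip: exp_double)
  finally show ?thesis .
qed

text \<open>Rotating \<open>I\<close> by a phase \<open>w\<close> preserves the modulus of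
  differences inside a group, while the crossing factor becomes a polynomial \<open>P\<close> in
  \<open>w\<close> of degree at most \<open>p * k * (N - k)\<close>. Its value at 0 has the modulus
  of the monomial part of \<open>G\<close>, so the mean square bound applies.\<close>

lemma mean_rotation_ge_G:
  assumes q: "p * k * (N - k) < q"
  shows "real q * (cmod (G x))\<^sup>2
    \<le> (\<Sum>s<q. (cmod (edge_prod (ordered_pairs U) (\<lambda>i. if i \<in> I then cis (2 * pi * real s / real q) * x i else x i)))\<^sup>2)"
proof -
  define P where "P = (\<Prod>i\<in>I. \<Prod>j\<in>J. [:x j, - x i:] ^ p)"
  have "degree P \<le> (\<Sum>i\<in>I. degree (\<Prod>j\<in>J. [:x j, - x i:] ^ p))"
    unfolding P_def using degree_prod_sum_le[OF fin(1)] by (simp add: o_def)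
  also have "\<dots> \<le> (\<Sum>i\<in>I. \<Sum>j\<in>J. p)"
  proof (rule sum_mono)
    fix i
    have "degree (\<Prod>j\<in>J. [:x j, - x i:] ^ p) \<le> (\<Sum>j\<in>J. degree ([:x j, - x i:] ^ p))"
      using degree_prod_sum_le[OF fin(2)] by (simp add: o_def)
    also have "\<dots> \<le> (\<Sum>j\<in>J. p)"
      by (intro sum_mono order.trans[OF degree_power_le]) simp
    finally show "degree (\<Prod>j\<in>J. [:x j, - x i:] ^ p) \<le> (\<Sum>j\<in>J. p)" .
  qed
  also have "\<dots> < q" using q by (simp add: I IJ mult_ac)
  finally have deg: "degree P < q" .
  have P: "cmod (poly P w) = (\<Prod>i\<in>I. \<Prod>j\<in>J. cmod (x j - w * x i) ^ p)" for w
    by (simp add: P_def poly_prod norm_power flip: prod_norm)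
  have rot: "cmod (edge_prod (ordered_pairs U) (\<lambda>i. if i \<in> I then w * x i else x i)) = cmod (edge_prod E x) * cmod (poly P w)"
    if w: "cmod w = 1" for w
  proof -
    have "cmod (edge_prod E (\<lambda>i. if i \<in> I then w * x i else x i)) = cmod (edge_prod E x)"
      unfolding edge_prod_def prod_norm[symmetric]
    proof (rule prod.cong[OF refl])
      fix e assume "e \<in> E"
      then have "(fst e \<in> I \<and> snd e \<in> I) \<or> (fst e \<notin> I \<and> snd e \<notin> I)"
        by (auto simp: E_def ordered_pairs_def J_def)
      then show "norm (((if snd e \<in> I then w * x (snd e) else x (snd e)) - (if fst e \<in> I then w * x (fst e) else x (fst e))) ^ p)
        = norm ((x (snd e) - x (fst e)) ^ p)"
        using w by (auto simp: norm_power norm_mult simp flip: right_diff_distrib)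
    qed
    moreover have "(\<Prod>i\<in>I. \<Prod>j\<in>J. cmod ((if j \<in> I then w * x j else x j) - (if i \<in> I then w * x i else x i)) ^ p)
        = cmod (poly P w)"
      unfolding P by (intro prod.cong refl) (auto simp: J_def)
    ultimately show ?thesis unfolding edge_prod_split by simp
  qed
  have P0: "cmod (G x) = cmod (edge_prod E x) * cmod (poly P 0)"
    by (simp add: G_def norm_mult norm_power P prod_c flip: prod_norm)
  have "real q * (cmod (G x))\<^sup>2 = (cmod (edge_prod E x))\<^sup>2 * (real q * (cmod (poly P 0))\<^sup>2)"
    by (simp add: P0 power_mult_distrib)
  also have "\<dots> \<le> (cmod (edge_prod E x))\<^sup>2 * (\<Sum>s<q. (cmod (poly P (cis (2 * pi * real s / real q))))\<^sup>2)"
    by (intro mult_left_mono mean_square_ge_value_at_0[OF deg]) auto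
  also have "\<dots> = (\<Sum>s<q. (cmod (edge_prod (ordered_pairs U) (\<lambda>i. if i \<in> I then cis (2 * pi * real s / real q) * x i else x i)))\<^sup>2)"
    by (simp add: rot power_mult_distrib sum_distrib_left)
  finally show ?thesis .
qed

lemma G_measurable: "(\<lambda>z. ennreal ((cmod (G (X z)))\<^sup>2)) \<in> borel_measurable \<mu>"
proof -
  have "fst e \<in> {..<N}" "snd e \<in> {..<N}" if "e \<in> E" for e
    using that I by (auto simp: E_def ordered_pairs_def J_def)
  then show ?thesis
    unfolding G_def X_def edge_prod_def config_measure_def by measurable
qed

lemma edge_prod_measurable:
  "(\<lambda>z. ennreal ((cmod (edge_prod (ordered_pairs U) (X z)))\<^sup>2)) \<in> borel_measurable \<mu>"
proof -
  have "fst e \<in> {..<N}" "snd e \<in> {..<N}" if "e \<in> ordered_pairs U" for e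
    using that by (auto simp: ordered_pairs_def)
  then show ?thesis
    unfolding X_def edge_prod_def config_measure_def by measurable
qed

lemma gauss_measurable [measurable]: "gauss \<in> borel_measurable \<mu>"
  unfolding gauss_def config_measure_def by measurable

lemma nn_integral_edge_prod_ge_G:
  assumes h [measurable]: "h \<in> borel_measurable \<mu>"
    and h_Re: "\<And>z w. (\<And>i. i \<in> U \<Longrightarrow> Re (z i) = Re (w i)) \<Longrightarrow> h z = h w"
  shows "(\<integral>\<^sup>+z. ennreal ((cmod (G (X z)))\<^sup>2) * h z \<partial>\<mu>)
    \<le> (\<integral>\<^sup>+z. ennreal ((cmod (edge_prod (ordered_pairs U) (X z)))\<^sup>2) * h z \<partial>\<mu>)"
proof -
  note [measurable] = G_measurable edge_prod_measurable
  define q where "q = Suc (p * k * (N - k))"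
  define \<theta> where "\<theta> s i = (if i \<in> I then R * (2 * pi * real s / real q) else 0)" for s i
  define f where "f z = ennreal ((cmod (edge_prod (ordered_pairs U) (X z)))\<^sup>2) * h z" for z
  have f: "f \<in> borel_measurable \<mu>" unfolding f_def by measurable
  have q: "p * k * (N - k) < q" "0 < q" by (auto simp: q_def)
  have \<theta>: "0 \<le> \<theta> s i \<and> \<theta> s i \<le> 2 * pi * R" if "s \<in> {..<q}" for s i
  proof -
    have "real s / real q \<le> 1" using that by simp
    then have "2 * pi * R * (real s / real q) \<le> 2 * pi * R"
      using R by (intro mult_left_le) auto
    then show ?thesis using R by (simp add: \<theta>_def mult_ac)
  qed
  have pw: "of_nat q * (ennreal ((cmod (G (X z)))\<^sup>2) * h z) \<le> (\<Sum>s<q. f (rotate_config R U (\<theta> s) z))" for z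
  proof -
    have "f (rotate_config R U (\<theta> s) z) = ennreal ((cmod (edge_prod (ordered_pairs U)
        (\<lambda>i. if i \<in> I then cis (2 * pi * real s / real q) * X z i else X z i)))\<^sup>2) * h z" for s
    proof -
      have "h (rotate_config R U (\<theta> s) z) = h z"
        by (rule h_Re) (simp add: rotate_config_def)
      moreover have "X (rotate_config R U (\<theta> s) z) i = (if i \<in> I then cis (2 * pi * real s / real q) * X z i else X z i)"
        if "i \<in> U" for i
        using that R by (simp add: rotate_config_def exp_rotate_cyl \<theta>_def X_def)
      then have "edge_prod (ordered_pairs U) (X (rotate_config R U (\<theta> s) z))
        = edge_prod (ordered_pairs U) (\<lambda>i. if i \<in> I then cis (2 * pi * real s / real q) * X z i else X z i)"
        unfolding edge_prod_def by (intro prod.cong) (auto simp: ordered_pairs_def)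
      ultimately show ?thesis unfolding f_def by simp
    qed
    then have "(\<Sum>s<q. f (rotate_config R U (\<theta> s) z)) = ennreal (\<Sum>s<q. (cmod (edge_prod (ordered_pairs U)
        (\<lambda>i. if i \<in> I then cis (2 * pi * real s / real q) * X z i else X z i)))\<^sup>2) * h z"
      by (simp add: sum_distrib_right flip: sum_ennreal)
    moreover have "of_nat q * ennreal ((cmod (G (X z)))\<^sup>2) = ennreal (real q * (cmod (G (X z)))\<^sup>2)"
      by (simp add: ennreal_mult ennreal_of_nat_eq_real_of_nat)
    ultimately show ?thesis using mean_rotation_ge_G[OF q(1), of "X z"]
      by (simp add: mult_right_mono ennreal_leI flip: mult.assoc)
  qed
  have "of_nat q * (\<integral>\<^sup>+z. ennreal ((cmod (G (X z)))\<^sup>2) * h z \<partial>\<mu>)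
      = (\<integral>\<^sup>+z. of_nat q * (ennreal ((cmod (G (X z)))\<^sup>2) * h z) \<partial>\<mu>)"
    by (rule nn_integral_cmult[symmetric]) measurable
  also have "\<dots> \<le> (\<integral>\<^sup>+z. (\<Sum>s<q. f (rotate_config R U (\<theta> s) z)) \<partial>\<mu>)"
    using pw by (rule nn_integral_mono)
  also have "\<dots> = of_nat q * (\<integral>\<^sup>+z. f z \<partial>\<mu>)"
    using nn_integral_mean_rotations[of U "{..<q}" \<theta> R f] \<theta> f unfolding config_measure_def by simp
  finally have "of_nat q * (\<integral>\<^sup>+z. ennreal ((cmod (G (X z)))\<^sup>2) * h z \<partial>\<mu>) \<le> of_nat q * (\<integral>\<^sup>+z. f z \<partial>\<mu>)" .
  then show ?thesis using q of_nat_less_top[of q] unfolding f_def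
    by (subst (asm) ennreal_mult_le_mult_iff) auto
qed

section \<open>Integrals over single particles\<close>

definition w :: "nat \<Rightarrow> real" where
  "w m = 2 * pi * R * R * exp ((real m)\<^sup>2 * a) * sqrt (pi * a)"

lemma w_pos: "0 < w m"
  using R a_pos by (simp add: w_def)

lemma ennreal_w: "ennreal (2 * pi * R * R * exp ((real m)\<^sup>2 * a)) * ennreal (sqrt (pi * a)) = ennreal (w m)"
  unfolding w_def using R a_pos by (intro ennreal_mult[symmetric]) auto

text \<open>Completing the square shifts the Gaussian to the centre \<open>m * a - b\<close> in the
  coordinate \<open>t = Re z / R - b\<close>. The circumference and the change of variables each
  bring a factor \<open>R\<close>; with \<phi> equal to 1 the total is \<open>w m\<close>.\<close>

lemma site_integral:
  fixes \<phi> :: "real \<Rightarrow> ennreal"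
  assumes [measurable]: "\<phi> \<in> borel_measurable borel"
  shows "(\<integral>\<^sup>+z. ennreal (exp (2 * real m * Re z / R)) * ennreal (exp (- ((Re z)\<^sup>2) / l\<^sup>2)) * \<phi> (Re z / R - b) \<partial>cyl_measure R)
    = ennreal (2 * pi * R * R * exp ((real m)\<^sup>2 * a))
      * (\<integral>\<^sup>+t. ennreal (exp (- ((t - (real m * a - b))\<^sup>2) / a)) * \<phi> t \<partial>lborel)"
proof -
  have "exp (2 * real m * (R * b + R * t) / R) * exp (- ((R * b + R * t)\<^sup>2) / l\<^sup>2)
      = exp ((real m)\<^sup>2 * a) * exp (- ((t - (real m * a - b))\<^sup>2) / a)" for t
  proof -
    have l2: "l\<^sup>2 = R\<^sup>2 * a" using R by (simp add: a_def power_divide)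
    have "(R * b + R * t)\<^sup>2 / l\<^sup>2 = (b + t)\<^sup>2 / a"
      unfolding l2 using R by (simp add: power_mult_distrib flip: distrib_left)
    moreover have "2 * real m * (R * b + R * t) / R = 2 * real m * (b + t)"
      using R by (simp add: field_simps)
    moreover have "2 * real m * (b + t) - (b + t)\<^sup>2 / a = (real m)\<^sup>2 * a - (t - (real m * a - b))\<^sup>2 / a"
      using a_pos by (simp add: field_simps power2_eq_square)
    ultimately show ?thesis by (simp flip: exp_add)
  qed
  then have eq: "ennreal (exp (2 * real m * (R * b + R * t) / R)) * ennreal (exp (- ((R * b + R * t)\<^sup>2) / l\<^sup>2))
      = ennreal (exp ((real m)\<^sup>2 * a)) * ennreal (exp (- ((t - (real m * a - b))\<^sup>2) / a))" for t
    by (simp flip: ennreal_mult')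
  have arg: "(R * b + R * t) / R - b = t" for t using R by (simp add: field_simps)
  have "(\<integral>\<^sup>+z. ennreal (exp (2 * real m * Re z / R)) * ennreal (exp (- ((Re z)\<^sup>2) / l\<^sup>2)) * \<phi> (Re z / R - b) \<partial>cyl_measure R)
    = ennreal (2 * pi * R) * (\<integral>\<^sup>+x. ennreal (exp (2 * real m * x / R)) * ennreal (exp (- (x\<^sup>2) / l\<^sup>2)) * \<phi> (x / R - b) \<partial>lborel)"
    by (rule nn_integral_cyl_measure_Re[OF _ R]) measurable
  also have "(\<integral>\<^sup>+x. ennreal (exp (2 * real m * x / R)) * ennreal (exp (- (x\<^sup>2) / l\<^sup>2)) * \<phi> (x / R - b) \<partial>lborel)
    = ennreal \<bar>R\<bar> * (\<integral>\<^sup>+t. ennreal (exp (2 * real m * (R * b + R * t) / R)) * ennreal (exp (- ((R * b + R * t)\<^sup>2) / l\<^sup>2))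
        * \<phi> ((R * b + R * t) / R - b) \<partial>lborel)"
    using R by (intro nn_integral_real_affine) measurable
  also have "\<dots> = ennreal R * (\<integral>\<^sup>+t. ennreal (exp ((real m)\<^sup>2 * a)) * (ennreal (exp (- ((t - (real m * a - b))\<^sup>2) / a)) * \<phi> t) \<partial>lborel)"
    unfolding eq arg using R by (simp add: mult.assoc)
  also have "\<dots> = ennreal R * (ennreal (exp ((real m)\<^sup>2 * a)) * (\<integral>\<^sup>+t. ennreal (exp (- ((t - (real m * a - b))\<^sup>2) / a)) * \<phi> t \<partial>lborel))"
    by (subst nn_integral_cmult) auto
  finally show ?thesis using R by (simp add: ennreal_mult mult_ac)
qed

lemma prod_site_integral:
  fixes \<phi> :: "nat \<Rightarrow> real \<Rightarrow> ennreal"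
  assumes [measurable]: "\<And>i. \<phi> i \<in> borel_measurable borel"
  shows "(\<integral>\<^sup>+z. (\<Prod>i\<in>U. ennreal (exp (2 * real (m i) * Re (z i) / R))) * (gauss z * (\<Prod>i\<in>U. \<phi> i (Re (z i) / R - b))) \<partial>\<mu>)
    = (\<Prod>i\<in>U. ennreal (2 * pi * R * R * exp ((real (m i))\<^sup>2 * a))
      * (\<integral>\<^sup>+t. ennreal (exp (- ((t - (real (m i) * a - b))\<^sup>2) / a)) * \<phi> i t \<partial>lborel))"
proof -
  interpret product_sigma_finite "\<lambda>_. cyl_measure R" by (rule product_sigma_finite_cyl)
  have "(\<integral>\<^sup>+z. (\<Prod>i\<in>U. ennreal (exp (2 * real (m i) * Re (z i) / R))) * (gauss z * (\<Prod>i\<in>U. \<phi> i (Re (z i) / R - b))) \<partial>\<mu>)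
    = (\<integral>\<^sup>+z. (\<Prod>i\<in>U. ennreal (exp (2 * real (m i) * Re (z i) / R)) * ennreal (exp (- ((Re (z i))\<^sup>2) / l\<^sup>2)) * \<phi> i (Re (z i) / R - b)) \<partial>\<mu>)"
    by (simp add: gauss_def prod.distrib mult.assoc)
  also have "\<dots> = (\<Prod>i\<in>U. \<integral>\<^sup>+z. ennreal (exp (2 * real (m i) * Re z / R)) * ennreal (exp (- ((Re z)\<^sup>2) / l\<^sup>2)) * \<phi> i (Re z / R - b) \<partial>cyl_measure R)"
    unfolding config_measure_def
    by (intro product_nn_integral_prod measurable_cyl_measure_borel) measurable
  finally show ?thesis by (simp only: site_integral[OF assms])
qed

text \<open>Ranks start at 1 separately on each side; thanks to \<sigma> a single inequality puts
  all Gaussian centres on their own sides, deeper as the rank grows.\<close>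

definition "labelling m lab \<longleftrightarrow> bij_betw lab I {1..k} \<and> bij_betw lab J {1..N - k}
  \<and> (\<forall>i\<in>U. \<sigma> i * (real (m i) * a - b) \<le> - (2 * \<epsilon> * real (lab i)))"

text \<open>Each rank occurs at most once on each side, so a sum over particles is at most twice the
  full series. This is what makes the final constants independent of \<open>N\<close> and
  \<open>k\<close>.\<close>

lemma labelling_sum_le:
  fixes f :: "nat \<Rightarrow> real"
  assumes "labelling m lab" "summable f" "\<And>r. 0 \<le> f r"
  shows "(\<Sum>i\<in>U. f (lab i)) \<le> 2 * suminf f"
proof -
  have "(\<Sum>i\<in>U. f (lab i)) = (\<Sum>i\<in>I. f (lab i)) + (\<Sum>i\<in>J. f (lab i))"
    using fin IJ by (metis sum.union_disjoint)
  also have "\<dots> = sum f {1..k} + sum f {1..N - k}"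
    using assms(1) sum.reindex_bij_betw[of lab I "{1..k}" f] sum.reindex_bij_betw[of lab J "{1..N - k}" f]
    unfolding labelling_def by argo
  also have "\<dots> \<le> suminf f + suminf f"
    using assms by (intro add_mono sum_le_suminf) auto
  finally show ?thesis by simp
qed

text \<open>Any \<open>r\<close> of the exponents in \<open>I\<close> (in \<open>J\<close>) have an extreme element beyond the bound
  on their average, which stays at a distance proportional to \<open>r\<close> from the cut.\<close>

lemma G_expansion:
  obtains M and \<alpha> :: "(nat \<Rightarrow> nat) \<Rightarrow> complex" where "finite M"
    and "\<forall>m\<in>M. (\<forall>i. i \<notin> U \<longrightarrow> m i = 0) \<and> (\<exists>lab. labelling m lab)"
    and "\<forall>x. G x = (\<Sum>m\<in>M. \<alpha> m * (\<Prod>i\<in>U. x i ^ m i))"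
proof -
  have EU: "E \<subseteq> U \<times> U" using I by (auto simp: E_def ordered_pairs_def J_def)
  obtain M and \<alpha> :: "(nat \<Rightarrow> nat) \<Rightarrow> complex" where M: "finite M" "\<forall>m\<in>M. \<forall>i. i \<notin> U \<longrightarrow> m i = 0"
    and lower: "\<forall>m\<in>M. \<forall>S. S \<subseteq> U \<longrightarrow> p * card {e\<in>E. fst e \<in> S \<and> snd e \<in> S} + sum c S \<le> sum m S"
    and upper: "\<forall>m\<in>M. \<forall>S. S \<subseteq> U \<longrightarrow> sum m S \<le> p * card {e\<in>E. fst e \<in> S \<or> snd e \<in> S} + sum c S"
    and eq: "\<forall>x. (\<Prod>e\<in>E. (x (snd e) - x (fst e)) ^ p) * (\<Prod>i\<in>U. x i ^ c i) = (\<Sum>m\<in>M. \<alpha> m * (\<Prod>i\<in>U. x i ^ m i))"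
    by (rule edge_product_expansion[OF finite_lessThan EU, where p=p and c=c]) (rule that; assumption)
  have "\<exists>lab. labelling m lab" if m: "m \<in> M" for m
  proof -
    \<comment> \<open>The bound is twice the largest possible average exponent over \<open>r\<close>
      elements of \<open>I\<close>, since \<open>r (2 k - r - 1) / 2\<close> edges of
      \<open>E\<close> meet such a set.\<close>
    have "\<exists>lab. bij_betw lab I {1..card I} \<and> (\<forall>i\<in>I. 2 * real (m i) \<le> real p * (2 * real k - real (lab i) - 1))"
    proof (rule labelling_exists[OF fin(1)])
      fix S assume S: "S \<subseteq> I" "S \<noteq> {}"
      have finS: "finite S" using S fin finite_subset by blast
      define r where "r = card S"
      have r: "r > 0" using S finS by (simp add: r_def card_gt_0_iff)
      have rk: "r \<le> k" using S fin I by (auto simp: r_def card_mono)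
      have "{e\<in>E. fst e \<in> S \<or> snd e \<in> S} = ordered_pairs I - ordered_pairs (I - S)"
        using S by (auto simp: E_def ordered_pairs_def J_def)
      moreover have "ordered_pairs (I - S) \<subseteq> ordered_pairs I" by (auto simp: ordered_pairs_def)
      ultimately have "real (card {e\<in>E. fst e \<in> S \<or> snd e \<in> S})
          = real (card (ordered_pairs I)) - real (card (ordered_pairs (I - S)))"
        using fin by (simp add: card_Diff_subset of_nat_diff card_mono)
      moreover have "2 * real (card (ordered_pairs I)) = real k * real k - real k"
        using arg_cong[OF card_ordered_pairs[OF fin(1)], of real] I by simp
      moreover have "card (I - S) = k - r" using S finS I by (simp add: card_Diff_subset r_def)
      then have "2 * real (card (ordered_pairs (I - S))) = (real k - real r) * (real k - real r) - (real k - real r)"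
        using arg_cong[OF card_ordered_pairs[of "I - S"], of real] fin rk by (simp add: of_nat_diff)
      ultimately have "2 * real (card {e\<in>E. fst e \<in> S \<or> snd e \<in> S}) = real r * (2 * real k - real r - 1)"
        by (simp add: algebra_simps)
      then have card2: "2 * (real p * real (card {e\<in>E. fst e \<in> S \<or> snd e \<in> S})) = real r * (real p * (2 * real k - real r - 1))"
        by (simp only: mult.left_commute[of 2 "real p"] mult.left_commute[of "real r" "real p"])
      have "sum c S = 0" using S by (intro sum.neutral) (auto simp: c_def J_def)
      then have "real (sum m S) \<le> real p * real (card {e\<in>E. fst e \<in> S \<or> snd e \<in> S})"
        using upper[rule_format, OF m, of S] S I by (simp flip: of_nat_mult del: of_nat_sum)
      then have le: "(\<Sum>i\<in>S. 2 * real (m i)) \<le> real r * (real p * (2 * real k - real r - 1))"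
        using card2 unfolding sum_distrib_left[symmetric] of_nat_sum by linarith
      show "\<exists>i\<in>S. 2 * real (m i) \<le> real p * (2 * real k - real (card S) - 1)"
      proof (rule ccontr)
        assume "\<not> ?thesis"
        then have "(\<Sum>i\<in>S. real p * (2 * real k - real r - 1)) < (\<Sum>i\<in>S. 2 * real (m i))"
          using finS S by (intro sum_strict_mono) (auto simp: r_def not_le)
        then show False using le by (simp add: r_def)
      qed
    qed
    then obtain lab1 where lab1: "bij_betw lab1 I {1..k}"
      "\<And>i. i \<in> I \<Longrightarrow> 2 * real (m i) \<le> real p * (2 * real k - real (lab1 i) - 1)" using I by auto
    \<comment> \<open>In \<open>J\<close> the average is bounded from below: besides the
      \<open>r (r - 1) / 2\<close> pairs inside \<open>S\<close>, every element carries the exponent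
      \<open>p * k\<close>.\<close>
    have "\<exists>lab. bij_betw lab J {1..card J} \<and> (\<forall>i\<in>J. real p * (2 * real k + real (lab i) - 1) \<le> 2 * real (m i))"
    proof (rule labelling_exists[OF fin(2)])
      fix S assume S: "S \<subseteq> J" "S \<noteq> {}"
      have finS: "finite S" using S fin finite_subset by blast
      define r where "r = card S"
      have "{e\<in>E. fst e \<in> S \<and> snd e \<in> S} = ordered_pairs S"
        using S by (auto simp: E_def ordered_pairs_def J_def)
      then have "2 * real (card {e\<in>E. fst e \<in> S \<and> snd e \<in> S}) = real r * real r - real r"
        using arg_cong[OF card_ordered_pairs[OF finS], of real] by (simp add: r_def)
      then have card2: "2 * (real p * real (card {e\<in>E. fst e \<in> S \<and> snd e \<in> S})) = real p * (real r * real r - real r)"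
        by (simp only: mult.left_commute[of 2 "real p"] mult.left_commute[of "real r" "real p"])
      have "sum c S = (\<Sum>i\<in>S. p * k)" using S by (intro sum.cong) (auto simp: c_def)
      then have "p * card {e\<in>E. fst e \<in> S \<and> snd e \<in> S} + r * (p * k) \<le> sum m S"
        using lower[rule_format, OF m, of S] S IJ(6) by (auto simp: r_def)
      then have "real p * real (card {e\<in>E. fst e \<in> S \<and> snd e \<in> S}) + real r * (real p * real k) \<le> real (sum m S)"
        by (simp flip: of_nat_mult of_nat_add del: of_nat_sum)
      then have le: "real r * (real p * (2 * real k + real r - 1)) \<le> (\<Sum>i\<in>S. 2 * real (m i))"
        using card2 unfolding sum_distrib_left[symmetric] of_nat_sum by (simp add: algebra_simps)
      show "\<exists>i\<in>S. real p * (2 * real k + real (card S) - 1) \<le> 2 * real (m i)"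
      proof (rule ccontr)
        assume "\<not> ?thesis"
        then have "(\<Sum>i\<in>S. 2 * real (m i)) < (\<Sum>i\<in>S. real p * (2 * real k + real r - 1))"
          using finS S by (intro sum_strict_mono) (auto simp: r_def not_le)
        then show False using le by (simp add: r_def)
      qed
    qed
    then obtain lab2 where lab2: "bij_betw lab2 J {1..N - k}"
      "\<And>i. i \<in> J \<Longrightarrow> real p * (2 * real k + real (lab2 i) - 1) \<le> 2 * real (m i)" unfolding IJ(3) by blast
    define lab where "lab i = (if i \<in> I then lab1 i else lab2 i)" for i
    have "bij_betw lab I {1..k}" using lab1(1) by (subst bij_betw_cong[of _ lab lab1]) (auto simp: lab_def)
    moreover have "bij_betw lab J {1..N - k}"
      using lab2(1) by (subst bij_betw_cong[of _ lab lab2]) (auto simp: lab_def J_def)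
    \<comment> \<open>The half in \<open>b\<close> centres the cut: the extreme exponents for rank
      \<open>r\<close> are \<open>p (2 k - 1 - r) / 2\<close> in \<open>I\<close> and
      \<open>p (2 k - 1 + r) / 2\<close> in \<open>J\<close>, both at depth
      \<open>r p a / 2\<close>.\<close>
    moreover have "\<sigma> i * (real (m i) * a - b) \<le> - (2 * \<epsilon> * real (lab i))" if "i \<in> U" for i
    proof (cases "i \<in> I")
      case True
      have "2 * real (m i) * (a / 2) \<le> real p * (2 * real k - real (lab1 i) - 1) * (a / 2)"
        using lab1(2)[OF True] a_pos by (intro mult_right_mono) auto
      then show ?thesis using True by (simp add: \<sigma>_def lab_def b_def \<epsilon>_def field_simps)
    next
      case False
      then have "i \<in> J" using that by (simp add: J_def)
      have "real p * (2 * real k + real (lab2 i) - 1) * (a / 2) \<le> 2 * real (m i) * (a / 2)"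
        using lab2(2)[OF \<open>i \<in> J\<close>] a_pos by (intro mult_right_mono) auto
      then show ?thesis using False by (simp add: \<sigma>_def lab_def b_def \<epsilon>_def field_simps)
    qed
    ultimately show ?thesis unfolding labelling_def by blast
  qed
  then show ?thesis using M eq by (intro that[of M \<alpha>]) (simp_all add: G_def edge_prod_def)
qed

section \<open>Ordered and separated configurations\<close>

definition "Ord = {z :: nat \<Rightarrow> complex. \<forall>i\<in>I. \<forall>j\<in>J. Re (z i) \<le> Re (z j)}"
text \<open>Strict inequalities make these events disjoint for different \<open>I\<close>, whereas
  the weak ones of \<open>Ord\<close> let those events cover all configurations.\<close>

definition "LR = {z :: nat \<Rightarrow> complex. \<forall>i\<in>U. \<sigma> i * (Re (z i) / R - b) < 0}"

definition "pair_weight z = exp (2 * real p * (\<Sum>i\<in>I. \<Sum>j\<in>J. exp (Re (z i) / R - Re (z j) / R)))"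
  for z :: "nat \<Rightarrow> complex"

lemma in_U: "i \<in> I \<Longrightarrow> i \<in> U" "i \<in> J \<Longrightarrow> i \<in> U"
  using I by (auto simp: J_def)

lemma Ord_indicator_measurable: "(indicator Ord :: _ \<Rightarrow> ennreal) \<in> borel_measurable \<mu>"
proof -
  have eq: "indicator Ord z = (\<Prod>i\<in>I. \<Prod>j\<in>J. if Re (z i) \<le> Re (z j) then 1 else 0 :: ennreal)" for z
    using fin by (auto simp: Ord_def indicator_def)
  note [measurable (raw)] = in_U
  show ?thesis unfolding eq[abs_def] config_measure_def by measurable
qed

lemma pair_weight_measurable: "pair_weight \<in> borel_measurable \<mu>"
proof -
  note [measurable (raw)] = in_U
  show ?thesis unfolding pair_weight_def config_measure_def by measurable
qed

lemma norm_X: "cmod (X z i) = exp (Re (z i) / R)"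
  by (simp add: X_def)

lemma indicator_LR: "indicator LR z = (\<Prod>i\<in>U. indicator {..<0} (\<sigma> i * (Re (z i) / R - b)) :: ennreal)"
  by (auto simp: LR_def indicator_def)

lemma LR_indicator_measurable: "(indicator LR :: _ \<Rightarrow> ennreal) \<in> borel_measurable \<mu>"
  unfolding indicator_LR[abs_def] config_measure_def by measurable

lemma site_weight_measurable [measurable]:
  "(\<lambda>t. ennreal (site_weight L \<epsilon> (1 / (4 * a)) r (s * t))) \<in> borel_measurable borel"
  unfolding site_weight_def by measurable

text \<open>On \<open>Ord\<close> the pair weight is at most a product of site weights, so the
  integral splits into single-particle Gaussian integrals. Their excess factors multiply to at most
  the exponential of the summed \<open>site_error\<close>.\<close>

lemma monomial_upper:
  assumes "labelling m lab"
  shows "(\<integral>\<^sup>+z. (\<Prod>i\<in>U. ennreal (exp (2 * real (m i) * Re (z i) / R)))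
        * (gauss z * indicator Ord z * ennreal (pair_weight z)) \<partial>\<mu>)
    \<le> ennreal (exp (2 * suminf (site_error L \<epsilon> a))) * (\<Prod>i\<in>U. ennreal (w (m i)))"
proof -
  define \<phi> where "\<phi> i t = ennreal (site_weight L \<epsilon> (1 / (4 * a)) (lab i) (\<sigma> i * t))" for i t
  have lab: "bij_betw lab I {1..k}" "bij_betw lab J {1..N - k}"
    and mean: "\<And>i. i \<in> U \<Longrightarrow> \<sigma> i * (real (m i) * a - b) \<le> - (2 * \<epsilon> * real (lab i))"
    using assms unfolding labelling_def by auto
  have pw: "indicator Ord z * ennreal (pair_weight z) \<le> (\<Prod>i\<in>U. \<phi> i (Re (z i) / R - b))" for z
  proof (cases "z \<in> Ord")
    case True
    define u where "u i = Re (z i) / R - b" for i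
    have "exp (2 * real p * (\<Sum>i\<in>I. \<Sum>j\<in>J. exp (u i - u j)))
        \<le> (\<Prod>i\<in>I. site_weight L \<epsilon> (1 / (4 * a)) (lab i) (u i)) * (\<Prod>j\<in>J. site_weight L \<epsilon> (1 / (4 * a)) (lab j) (- u j))"
    proof (rule interaction_le_site_weights)
      show "inj_on lab I" "inj_on lab J" using lab by (auto simp: bij_betw_def)
      have "lab ` I = {1..k}" "lab ` J = {1..N - k}" using lab by (auto simp: bij_betw_def)
      then show "1 \<le> lab i" if "i \<in> I \<union> J" for i using that by (metis Un_iff atLeastAtMost_iff imageI)
      show "u i \<le> u j" if "i \<in> I" "j \<in> J" for i j
        using that True R by (auto simp: u_def Ord_def divide_right_mono)
      show "L = 2 * real p + (2 * real p)\<^sup>2 / (2 * (1 / (4 * a)) * \<epsilon>\<^sup>2)" by (simp add: L_def)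
    qed (use fin IJ eps_pos a_pos in auto)
    also have "\<dots> = (\<Prod>i\<in>U. site_weight L \<epsilon> (1 / (4 * a)) (lab i) (\<sigma> i * u i))"
    proof -
      have "(\<Prod>i\<in>U. site_weight L \<epsilon> (1 / (4 * a)) (lab i) (\<sigma> i * u i))
          = (\<Prod>i\<in>I. site_weight L \<epsilon> (1 / (4 * a)) (lab i) (\<sigma> i * u i)) * (\<Prod>i\<in>J. site_weight L \<epsilon> (1 / (4 * a)) (lab i) (\<sigma> i * u i))"
        unfolding IJ(1)[symmetric] by (rule prod.union_disjoint[OF fin(1,2) IJ(2)])
      also have "\<dots> = (\<Prod>i\<in>I. site_weight L \<epsilon> (1 / (4 * a)) (lab i) (u i)) * (\<Prod>j\<in>J. site_weight L \<epsilon> (1 / (4 * a)) (lab j) (- u j))"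
        by (intro arg_cong2[where f="(*)"] prod.cong) (auto simp: \<sigma>_def J_def)
      finally show ?thesis by simp
    qed
    finally have "ennreal (pair_weight z) \<le> ennreal (\<Prod>i\<in>U. site_weight L \<epsilon> (1 / (4 * a)) (lab i) (\<sigma> i * u i))"
      by (intro ennreal_leI) (simp add: pair_weight_def u_def)
    also have "\<dots> = (\<Prod>i\<in>U. \<phi> i (Re (z i) / R - b))"
      unfolding \<phi>_def u_def by (rule prod_ennreal[symmetric]) (simp add: site_weight_def)
    finally show ?thesis using True by simp
  qed simp
  have "(\<integral>\<^sup>+z. (\<Prod>i\<in>U. ennreal (exp (2 * real (m i) * Re (z i) / R)))
        * (gauss z * indicator Ord z * ennreal (pair_weight z)) \<partial>\<mu>)
    \<le> (\<integral>\<^sup>+z. (\<Prod>i\<in>U. ennreal (exp (2 * real (m i) * Re (z i) / R))) * (gauss z * (\<Prod>i\<in>U. \<phi> i (Re (z i) / R - b))) \<partial>\<mu>)"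
    unfolding mult.assoc using pw by (intro nn_integral_mono mult_left_mono) auto
  also have "\<dots> = (\<Prod>i\<in>U. ennreal (2 * pi * R * R * exp ((real (m i))\<^sup>2 * a))
      * (\<integral>\<^sup>+t. ennreal (exp (- ((t - (real (m i) * a - b))\<^sup>2) / a)) * \<phi> i t \<partial>lborel))"
    by (rule prod_site_integral) (simp add: \<phi>_def)
  also have "\<dots> \<le> (\<Prod>i\<in>U. ennreal (2 * pi * R * R * exp ((real (m i))\<^sup>2 * a))
      * (ennreal (exp (site_error L \<epsilon> a (lab i))) * ennreal (sqrt (pi * a))))"
    unfolding \<phi>_def
    by (intro prod_mono_ennreal mult_left_mono gaussian_site_weight_le a_pos eps_pos L_nonneg sigma)
       (auto simp: mean)
  also have "\<dots> = (\<Prod>i\<in>U. ennreal (exp (site_error L \<epsilon> a (lab i)))) * (\<Prod>i\<in>U. ennreal (w (m i)))"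
    unfolding prod.distrib[symmetric] ennreal_w[symmetric] by (simp only: mult_ac)
  also have "(\<Prod>i\<in>U. ennreal (exp (site_error L \<epsilon> a (lab i)))) = ennreal (exp (\<Sum>i\<in>U. site_error L \<epsilon> a (lab i)))"
    by (simp add: prod_ennreal exp_sum)
  also have "\<dots> \<le> ennreal (exp (2 * suminf (site_error L \<epsilon> a)))"
    using labelling_sum_le[OF assms summable_site_error[OF a_pos eps_pos], of L] L_nonneg
    by (intro ennreal_leI) (simp add: site_error_def)
  finally show ?thesis by (simp add: mult_right_mono)
qed

text \<open>\<open>LR\<close> is a product event, so the integral factorises exactly, and each
  factor retains at least \<open>exp (- \<tau> r)\<close> of its mass for its rank
  \<open>r\<close>.\<close>

lemma monomial_lower:
  assumes "labelling m lab"
  shows "ennreal (exp (- (2 * (\<Sum>r. exp (- ((2 * \<epsilon> * real r)\<^sup>2) / a))))) * (\<Prod>i\<in>U. ennreal (w (m i)))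
    \<le> (\<integral>\<^sup>+z. (\<Prod>i\<in>U. ennreal (exp (2 * real (m i) * Re (z i) / R))) * (gauss z * indicator LR z) \<partial>\<mu>)"
proof -
  define \<tau> where "\<tau> r = exp (- ((2 * \<epsilon> * real r)\<^sup>2) / a)" for r :: nat
  define \<phi> where "\<phi> i t = (indicator {..<0} (\<sigma> i * t) :: ennreal)" for i t
  have mean: "\<And>i. i \<in> U \<Longrightarrow> \<sigma> i * (real (m i) * a - b) \<le> - (2 * \<epsilon> * real (lab i))"
    using assms unfolding labelling_def by auto
  have "(\<Sum>i\<in>U. \<tau> (lab i)) \<le> 2 * suminf \<tau>"
    using summable_gaussian_tail[OF a_pos eps_pos]
    by (intro labelling_sum_le[OF assms]) (auto simp: \<tau>_def)
  then have "ennreal (exp (- (2 * suminf \<tau>))) \<le> ennreal (exp (\<Sum>i\<in>U. - \<tau> (lab i)))"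
    by (intro ennreal_leI) (simp add: sum_negf)
  also have "\<dots> = (\<Prod>i\<in>U. ennreal (exp (- \<tau> (lab i))))"
    by (simp add: prod_ennreal exp_sum)
  finally have "ennreal (exp (- (2 * suminf \<tau>))) * (\<Prod>i\<in>U. ennreal (w (m i)))
      \<le> (\<Prod>i\<in>U. ennreal (exp (- \<tau> (lab i)))) * (\<Prod>i\<in>U. ennreal (w (m i)))"
    by (rule mult_right_mono) simp
  also have "\<dots> = (\<Prod>i\<in>U. ennreal (2 * pi * R * R * exp ((real (m i))\<^sup>2 * a))
      * (ennreal (exp (- \<tau> (lab i))) * ennreal (sqrt (pi * a))))"
    unfolding prod.distrib[symmetric] ennreal_w[symmetric] by (simp only: mult_ac)
  also have "\<dots> \<le> (\<Prod>i\<in>U. ennreal (2 * pi * R * R * exp ((real (m i))\<^sup>2 * a))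
      * (\<integral>\<^sup>+t. ennreal (exp (- ((t - (real (m i) * a - b))\<^sup>2) / a)) * \<phi> i t \<partial>lborel))"
    unfolding \<phi>_def \<tau>_def using eps_pos
    by (intro prod_mono_ennreal mult_left_mono gaussian_half_line_ge a_pos sigma)
       (auto simp: mean)
  also have "\<dots> = (\<integral>\<^sup>+z. (\<Prod>i\<in>U. ennreal (exp (2 * real (m i) * Re (z i) / R))) * (gauss z * (\<Prod>i\<in>U. \<phi> i (Re (z i) / R - b))) \<partial>\<mu>)"
    by (rule prod_site_integral[symmetric]) (simp add: \<phi>_def)
  finally show ?thesis unfolding \<phi>_def \<tau>_def indicator_LR .
qed

text \<open>Distinct nonzero arguments keep every factor of \<open>G\<close> away from 0. Hence some
  coefficient of its expansion is nonzero, which makes the mass \<open>S\<close> of the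
  \<open>G\<close> ensemble positive.\<close>

lemma G_nonzero: "G (\<lambda>i. of_nat (Suc i)) \<noteq> 0"
proof -
  have "snd e \<noteq> fst e" if "e \<in> E" for e using that by (auto simp: E_def ordered_pairs_def)
  then have "edge_prod E (\<lambda>i. of_nat (Suc i)) \<noteq> 0"
    using fin(3) by (auto simp: edge_prod_def)
  moreover have "(\<Prod>i\<in>U. (of_nat (Suc i) :: complex) ^ c i) \<noteq> 0"
    by (simp del: of_nat_Suc)
  ultimately show ?thesis by (simp add: G_def del: of_nat_Suc)
qed

lemma cut_bounds:
  obtains S :: real where "0 < S"
    and "(\<integral>\<^sup>+z. ennreal ((cmod (laughlin_Psi p R l N z))\<^sup>2) * indicator Ord z \<partial>\<mu>)
      \<le> ennreal (exp (2 * suminf (site_error L \<epsilon> a)) * S)"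
    and "ennreal (exp (- (2 * (\<Sum>r. exp (- ((2 * \<epsilon> * real r)\<^sup>2) / a)))) * S)
      \<le> (\<integral>\<^sup>+z. ennreal ((cmod (laughlin_Psi p R l N z))\<^sup>2) * indicator LR z \<partial>\<mu>)"
proof -
  note [measurable] = G_measurable edge_prod_measurable Ord_indicator_measurable LR_indicator_measurable pair_weight_measurable
  have Psi: "ennreal ((cmod (laughlin_Psi p R l N z))\<^sup>2) = ennreal ((cmod (edge_prod (ordered_pairs U) (X z)))\<^sup>2) * gauss z" for z
    by (simp add: laughlin_Psi_norm_square edge_prod_def X_def gauss_def)
  obtain M \<alpha> where M: "finite M" "\<forall>m\<in>M. (\<forall>i. i \<notin> U \<longrightarrow> m i = 0) \<and> (\<exists>lab. labelling m lab)"
    "\<forall>x. G x = (\<Sum>m\<in>M. \<alpha> m * (\<Prod>i\<in>U. x i ^ m i))"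
    by (rule G_expansion)
  note G_eq = M(3)[rule_format]
  have lab: "\<exists>lab. labelling m lab" if "m \<in> M" for m using M(2) that by simp
  have parseval: "(\<integral>\<^sup>+z. ennreal ((cmod (G (X z)))\<^sup>2) * h z \<partial>\<mu>)
      = (\<Sum>m\<in>M. ennreal ((cmod (\<alpha> m))\<^sup>2) * (\<integral>\<^sup>+z. (\<Prod>i\<in>U. ennreal (exp (2 * real (m i) * Re (z i) / R))) * h z \<partial>\<mu>))"
    if h: "h \<in> borel_measurable \<mu>" "\<And>z w. (\<And>i. i \<in> U \<Longrightarrow> Re (z i) = Re (w i)) \<Longrightarrow> h z = h w" for h
    unfolding G_eq X_def config_measure_def
  proof (rule nn_integral_parseval[OF finite_lessThan M(1) R])
    show "m i = 0" if "m \<in> M" "i \<notin> U" for m i using M(2) that by blast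
    show "h \<in> borel_measurable (Pi\<^sub>M U (\<lambda>_. cyl_measure R))"
      using h(1) unfolding config_measure_def .
  qed (rule h(2))
  \<comment> \<open>By the Parseval identity this is the integral of \<open>|G|^2 * gauss\<close>.
    Both bounds refer to this same number, so that its size drops out of the final quotient.\<close>
  define S where "S = (\<Sum>m\<in>M. (cmod (\<alpha> m))\<^sup>2 * (\<Prod>i\<in>U. w (m i)))"
  have w0: "0 \<le> w n" for n using w_pos[of n] by simp
  have S_eq: "ennreal S = (\<Sum>m\<in>M. ennreal ((cmod (\<alpha> m))\<^sup>2) * (\<Prod>i\<in>U. ennreal (w (m i))))"
    unfolding S_def using w0 by (simp add: ennreal_mult prod_nonneg prod_ennreal flip: sum_ennreal)
  have S: "0 < S"
  proof -
    obtain m where "m \<in> M" "\<alpha> m \<noteq> 0"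
      using G_nonzero unfolding G_eq by (auto elim!: sum.not_neutral_contains_not_neutral)
    then show ?thesis unfolding S_def using M(1) w0 w_pos
      by (intro sum_pos2[of M m]) (auto intro!: mult_pos_pos prod_pos mult_nonneg_nonneg prod_nonneg)
  qed
  have Re_gauss: "gauss z = gauss z'" if "\<And>i. i \<in> U \<Longrightarrow> Re (z i) = Re (z' i)" for z z'
    using that unfolding gauss_def by (auto intro!: prod.cong)
  show ?thesis
  proof (rule that[OF S])
    let ?h = "\<lambda>z. gauss z * indicator Ord z * ennreal (pair_weight z)"
    have "(\<integral>\<^sup>+z. ennreal ((cmod (laughlin_Psi p R l N z))\<^sup>2) * indicator Ord z \<partial>\<mu>)
        \<le> (\<integral>\<^sup>+z. ennreal ((cmod (G (X z)))\<^sup>2) * ?h z \<partial>\<mu>)"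
    proof (rule nn_integral_mono)
      fix z
      have "(cmod (edge_prod (ordered_pairs U) (X z)))\<^sup>2 \<le> (cmod (G (X z)))\<^sup>2 * pair_weight z"
        using edge_prod_le_G[of "X z"] unfolding pair_weight_def norm_X exp_diff by (simp add: X_def)
      then have "ennreal ((cmod (edge_prod (ordered_pairs U) (X z)))\<^sup>2) \<le> ennreal ((cmod (G (X z)))\<^sup>2) * ennreal (pair_weight z)"
        by (simp add: pair_weight_def ennreal_leI flip: ennreal_mult')
      then have "ennreal ((cmod (edge_prod (ordered_pairs U) (X z)))\<^sup>2) * (gauss z * indicator Ord z)
          \<le> ennreal ((cmod (G (X z)))\<^sup>2) * ennreal (pair_weight z) * (gauss z * indicator Ord z)"
        by (rule mult_right_mono) simp
      then show "ennreal ((cmod (laughlin_Psi p R l N z))\<^sup>2) * indicator Ord z \<le> ennreal ((cmod (G (X z)))\<^sup>2) * ?h z"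
        unfolding Psi by (simp add: mult_ac)
    qed
    also have "\<dots> = (\<Sum>m\<in>M. ennreal ((cmod (\<alpha> m))\<^sup>2) * (\<integral>\<^sup>+z. (\<Prod>i\<in>U. ennreal (exp (2 * real (m i) * Re (z i) / R))) * ?h z \<partial>\<mu>))"
    proof (rule parseval)
      fix z z' :: "nat \<Rightarrow> complex" assume Re: "\<And>i. i \<in> U \<Longrightarrow> Re (z i) = Re (z' i)"
      have "Re (z i) = Re (z' i)" if "i \<in> I \<or> i \<in> J" for i using Re in_U that by blast
      then have "indicator Ord z = (indicator Ord z' :: ennreal)" "pair_weight z = pair_weight z'"
        unfolding Ord_def pair_weight_def indicator_def by (auto cong: sum.cong)
      then show "?h z = ?h z'" using Re_gauss[OF Re] by simp
    qed measurable
    also have "\<dots> \<le> (\<Sum>m\<in>M. ennreal ((cmod (\<alpha> m))\<^sup>2) * (ennreal (exp (2 * suminf (site_error L \<epsilon> a))) * (\<Prod>i\<in>U. ennreal (w (m i)))))"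
      using lab monomial_upper by (intro sum_mono mult_left_mono) auto
    also have "\<dots> = ennreal (exp (2 * suminf (site_error L \<epsilon> a))) * ennreal S"
      unfolding S_eq by (simp add: sum_distrib_left mult_ac)
    finally show "(\<integral>\<^sup>+z. ennreal ((cmod (laughlin_Psi p R l N z))\<^sup>2) * indicator Ord z \<partial>\<mu>)
      \<le> ennreal (exp (2 * suminf (site_error L \<epsilon> a)) * S)" using S by (simp add: ennreal_mult)
  next
    let ?D = "exp (- (2 * (\<Sum>r. exp (- ((2 * \<epsilon> * real r)\<^sup>2) / a))))"
    let ?h = "\<lambda>z. gauss z * indicator LR z"
    have h_Re: "?h z = ?h z'" if Re: "\<And>i. i \<in> U \<Longrightarrow> Re (z i) = Re (z' i)" for z z'
    proof -
      have "indicator LR z = (indicator LR z' :: ennreal)"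
        unfolding indicator_LR using Re by (auto intro!: prod.cong)
      then show ?thesis using Re_gauss[OF Re] by simp
    qed
    have "ennreal (?D * S) = ennreal ?D * ennreal S" using S by (intro ennreal_mult) auto
    also have "\<dots> = (\<Sum>m\<in>M. ennreal ((cmod (\<alpha> m))\<^sup>2) * (ennreal ?D * (\<Prod>i\<in>U. ennreal (w (m i)))))"
      unfolding S_eq sum_distrib_left by (simp only: mult_ac)
    also have "\<dots> \<le> (\<Sum>m\<in>M. ennreal ((cmod (\<alpha> m))\<^sup>2) * (\<integral>\<^sup>+z. (\<Prod>i\<in>U. ennreal (exp (2 * real (m i) * Re (z i) / R))) * ?h z \<partial>\<mu>))"
      using lab monomial_lower by (intro sum_mono mult_left_mono) auto
    also have "\<dots> = (\<integral>\<^sup>+z. ennreal ((cmod (G (X z)))\<^sup>2) * ?h z \<partial>\<mu>)"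
      by (rule parseval[symmetric]) (measurable, rule h_Re)
    also have "\<dots> \<le> (\<integral>\<^sup>+z. ennreal ((cmod (edge_prod (ordered_pairs U) (X z)))\<^sup>2) * ?h z \<partial>\<mu>)"
      by (rule nn_integral_edge_prod_ge_G) (measurable, rule h_Re)
    also have "\<dots> = (\<integral>\<^sup>+z. ennreal ((cmod (laughlin_Psi p R l N z))\<^sup>2) * indicator LR z \<partial>\<mu>)"
      unfolding Psi by (simp add: mult.assoc)
    finally show "ennreal (?D * S) \<le> (\<integral>\<^sup>+z. ennreal ((cmod (laughlin_Psi p R l N z))\<^sup>2) * indicator LR z \<partial>\<mu>)" .
  qed
qed

end

section \<open>The probability of zero excess\<close>

theorem theorem5p3:
  fixes p :: nat and \<gamma> :: real
  assumes "p \<ge> 1" and "\<gamma> > 0"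
  shows "\<exists>c::real. 0 < c \<and>
           (\<forall>R l N k. R > 0 \<longrightarrow> l > 0 \<longrightarrow> l / R = \<gamma> \<longrightarrow> N \<ge> 2 \<longrightarrow> 1 \<le> k \<longrightarrow> k \<le> N - 1 \<longrightarrow>
              (let xbar = (real k - 1/2) * real p * l\<^sup>2 / R in
               emeasure (laughlin_prob p R l N)
                 {z \<in> space (laughlin_prob p R l N). particle_excess N k xbar z = 0}
               \<ge> ennreal (1 / c)))"
proof -
  \<comment> \<open>\<open>a\<close> depends on \<gamma> alone, so \<open>C\<close> and
    \<open>D\<close> are fixed before \<open>R\<close>, \<open>l\<close>, \<open>N\<close> and
    \<open>k\<close> are chosen.\<close>
  define a where "a = \<gamma>\<^sup>2"
  define \<epsilon> where "\<epsilon> = real p * a / 4"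
  define L where "L = 2 * real p + (2 * real p)\<^sup>2 / (2 * (1 / (4 * a)) * \<epsilon>\<^sup>2)"
  define C where "C = exp (2 * suminf (site_error L \<epsilon> a))"
  define D where "D = exp (- (2 * (\<Sum>r. exp (- ((2 * \<epsilon> * real r)\<^sup>2) / a))))"
  have CD: "0 < C" "0 < D" by (auto simp: C_def D_def)
  show ?thesis
  proof (intro exI[of _ "C / D"] conjI allI impI)
    show "0 < C / D" using CD by simp
    fix R l :: real and N k :: nat
    assume R: "R > 0" and l: "l > 0" and \<gamma>: "l / R = \<gamma>" and N: "N \<ge> 2" and k: "1 \<le> k" "k \<le> N - 1"
    define xbar where "xbar = (real k - 1/2) * real p * l\<^sup>2 / R"
    define \<F> where "\<F> = {I. I \<subseteq> {..<N} \<and> card I = k}"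
    define Q where "Q z = ennreal ((cmod (laughlin_Psi p R l N z))\<^sup>2)" for z
    let ?\<mu> = "config_measure R N"
    define A where "A = {z \<in> space ?\<mu>. particle_excess N k xbar z = 0}"
    define Ord where "Ord I = {z :: nat \<Rightarrow> complex. \<forall>i\<in>I. \<forall>j\<in>{..<N} - I. Re (z i) \<le> Re (z j)}" for I
    define LR where "LR I = {z :: nat \<Rightarrow> complex. (\<forall>i\<in>I. Re (z i) < xbar) \<and> (\<forall>j\<in>{..<N} - I. xbar < Re (z j))}" for I
    have fin\<F>: "finite \<F>" unfolding \<F>_def by (rule finite_subset[of _ "Pow {..<N}"]) auto
    have Q_meas [measurable]: "Q \<in> borel_measurable ?\<mu>"
    proof -
      have "fst e \<in> {..<N}" "snd e \<in> {..<N}" if "e \<in> ordered_pairs {..<N}" for e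
        using that by (auto simp: ordered_pairs_def)
      then show ?thesis unfolding Q_def laughlin_Psi_norm_square config_measure_def by measurable
    qed
    have cut: "\<exists>S>0. (\<integral>\<^sup>+z. Q z * indicator (Ord I) z \<partial>?\<mu>) \<le> ennreal (C * S)
        \<and> ennreal (D * S) \<le> (\<integral>\<^sup>+z. Q z * indicator (LR I) z \<partial>?\<mu>)
        \<and> (indicator (Ord I) :: _ \<Rightarrow> ennreal) \<in> borel_measurable ?\<mu>
        \<and> (indicator (LR I) :: _ \<Rightarrow> ennreal) \<in> borel_measurable ?\<mu>" if "I \<in> \<F>" for I
    proof -
      interpret cut: laughlin_cut p N k R l I
        using assms R l k N that by unfold_locales (auto simp: \<F>_def)
      have "cut.a = a" by (simp add: cut.a_def a_def \<gamma>)
      then have "cut.\<epsilon> = \<epsilon>" by (simp add: cut.\<epsilon>_def \<epsilon>_def)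
      then have "cut.L = L" using \<open>cut.a = a\<close> by (simp add: cut.L_def L_def)
      note eqs = \<open>cut.a = a\<close> \<open>cut.\<epsilon> = \<epsilon>\<close> \<open>cut.L = L\<close>
      have "cut.b = xbar / R"
        using R by (simp add: cut.b_def cut.a_def xbar_def power_divide power2_eq_square)
      then have "cut.LR = LR I"
        using that R unfolding cut.LR_def LR_def \<F>_def cut.\<sigma>_def by (auto simp: field_simps)
      moreover have "cut.Ord = Ord I" by (simp add: cut.Ord_def Ord_def cut.J_def)
      moreover obtain S where "0 < S"
        "(\<integral>\<^sup>+z. ennreal ((cmod (laughlin_Psi p R l N z))\<^sup>2) * indicator cut.Ord z \<partial>?\<mu>)
          \<le> ennreal (exp (2 * suminf (site_error cut.L cut.\<epsilon> cut.a)) * S)"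
        "ennreal (exp (- (2 * (\<Sum>r. exp (- ((2 * cut.\<epsilon> * real r)\<^sup>2) / cut.a)))) * S)
          \<le> (\<integral>\<^sup>+z. ennreal ((cmod (laughlin_Psi p R l N z))\<^sup>2) * indicator cut.LR z \<partial>?\<mu>)"
        by (rule cut.cut_bounds)
      ultimately show ?thesis
        using cut.Ord_indicator_measurable cut.LR_indicator_measurable
        unfolding Q_def C_def D_def eqs by (intro exI[of _ S]) simp
    qed
    have meas: "(\<lambda>z. Q z * indicator (Ord I) z) \<in> borel_measurable ?\<mu>"
        "(\<lambda>z. Q z * indicator (LR I) z) \<in> borel_measurable ?\<mu>" if "I \<in> \<F>" for I
      using cut[OF that] Q_meas by (auto intro!: borel_measurable_times_ennreal)
    have "(\<integral>\<^sup>+z. Q z \<partial>?\<mu>) \<le> (\<integral>\<^sup>+z. (\<Sum>I\<in>\<F>. Q z * indicator (Ord I) z) \<partial>?\<mu>)"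
    \<comment> \<open>Every configuration lies in some \<open>Ord I\<close>, possibly in several
      because of ties, hence only an inequality.\<close>
    proof (rule nn_integral_mono)
      fix z :: "nat \<Rightarrow> complex"
      have "k \<le> card {..<N}" using k by simp
      from ordered_initial_subset_exists[OF finite_lessThan this, of "\<lambda>i. Re (z i)"]
      obtain I where I: "I \<in> \<F>" "z \<in> Ord I"
        unfolding \<F>_def Ord_def by blast
      then have "Q z = Q z * indicator (Ord I) z" by simp
      also have "\<dots> \<le> (\<Sum>I\<in>\<F>. Q z * indicator (Ord I) z)"
        using I fin\<F> by (intro member_le_sum) auto
      finally show "Q z \<le> (\<Sum>I\<in>\<F>. Q z * indicator (Ord I) z)" .
    qed
    also have "\<dots> = (\<Sum>I\<in>\<F>. \<integral>\<^sup>+z. Q z * indicator (Ord I) z \<partial>?\<mu>)"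
      by (rule nn_integral_sum) (rule meas(1))
    finally have Z_le: "(\<integral>\<^sup>+z. Q z \<partial>?\<mu>) \<le> (\<Sum>I\<in>\<F>. \<integral>\<^sup>+z. Q z * indicator (Ord I) z \<partial>?\<mu>)" .
    have "(\<Sum>I\<in>\<F>. \<integral>\<^sup>+z. Q z * indicator (LR I) z \<partial>?\<mu>) = (\<integral>\<^sup>+z. (\<Sum>I\<in>\<F>. Q z * indicator (LR I) z) \<partial>?\<mu>)"
      by (rule nn_integral_sum[symmetric]) (rule meas(2))
    also have "\<dots> \<le> (\<integral>\<^sup>+z. Q z * indicator A z \<partial>?\<mu>)"
    proof (rule nn_integral_mono)
      fix z assume z: "z \<in> space ?\<mu>"
      \<comment> \<open>The only \<open>I\<close> whose event \<open>LR I\<close> can contain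
        \<open>z\<close> is the set of particles up to \<open>xbar\<close>, and then the excess
        vanishes; so at most one summand survives.\<close>
      let ?I = "{j \<in> {..<N}. Re (z j) \<le> xbar}"
      have "Q z * indicator (LR I) z \<le> (if I = ?I then Q z * indicator A z else 0)" if "I \<in> \<F>" for I
      proof (cases "z \<in> LR I")
        case True
        have I: "I \<subseteq> {..<N}" "card I = k" using that by (auto simp: \<F>_def)
        have lt: "Re (z i) < xbar" if "i \<in> I" for i using True that by (simp add: LR_def)
        have gt: "xbar < Re (z j)" if "j < N" "j \<notin> I" for j using True that by (simp add: LR_def)
        have "I = ?I"
        proof (intro set_eqI iffI)
          fix x assume "x \<in> I"
          then show "x \<in> ?I" using I(1) lt[of x] by auto
        next
          fix x assume "x \<in> ?I"
          then show "x \<in> I" using gt[of x] by force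
        qed
        moreover have "z \<in> A" using I(2) z unfolding A_def particle_excess_def \<open>I = ?I\<close> by simp
        ultimately show ?thesis by (simp split: split_indicator)
      qed simp
      then have "(\<Sum>I\<in>\<F>. Q z * indicator (LR I) z) \<le> (\<Sum>I\<in>\<F>. if I = ?I then Q z * indicator A z else 0)"
        by (rule sum_mono)
      also have "\<dots> \<le> Q z * indicator A z" using fin\<F> by (simp add: sum.delta)
      finally show "(\<Sum>I\<in>\<F>. Q z * indicator (LR I) z) \<le> Q z * indicator A z" .
    qed
    finally have A_ge: "(\<Sum>I\<in>\<F>. \<integral>\<^sup>+z. Q z * indicator (LR I) z \<partial>?\<mu>) \<le> (\<integral>\<^sup>+z. Q z * indicator A z \<partial>?\<mu>)" .
    have "\<forall>I\<in>\<F>. \<exists>S>0. (\<integral>\<^sup>+z. Q z * indicator (Ord I) z \<partial>?\<mu>) \<le> ennreal (C * S)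
        \<and> ennreal (D * S) \<le> (\<integral>\<^sup>+z. Q z * indicator (LR I) z \<partial>?\<mu>)"
      using cut by blast
    from bchoice[OF this] obtain S where S: "\<forall>I\<in>\<F>. 0 < S I
        \<and> (\<integral>\<^sup>+z. Q z * indicator (Ord I) z \<partial>?\<mu>) \<le> ennreal (C * S I)
        \<and> ennreal (D * S I) \<le> (\<integral>\<^sup>+z. Q z * indicator (LR I) z \<partial>?\<mu>)"
      by blast
    define T where "T = (\<Sum>I\<in>\<F>. S I)"
    \<comment> \<open>The family is nonempty, so \<open>T\<close> is positive and can be cancelled
      in the quotient.\<close>
    have "{..<k} \<in> \<F>" using k by (auto simp: \<F>_def)
    then have T: "0 < T" unfolding T_def using fin\<F> S by (intro sum_pos) auto
    have Z_upper: "(\<integral>\<^sup>+z. Q z \<partial>?\<mu>) \<le> ennreal (C * T)"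
    proof -
      have "(\<integral>\<^sup>+z. Q z \<partial>?\<mu>) \<le> (\<Sum>I\<in>\<F>. ennreal (C * S I))"
        using S by (intro order.trans[OF Z_le] sum_mono) simp
      also have "\<dots> = ennreal (C * T)"
        unfolding T_def sum_distrib_left using S CD by (intro sum_ennreal) (simp add: less_imp_le)
      finally show ?thesis .
    qed
    have A_lower: "ennreal (D * T) \<le> (\<integral>\<^sup>+z. Q z * indicator A z \<partial>?\<mu>)"
    proof -
      have "ennreal (D * T) = (\<Sum>I\<in>\<F>. ennreal (D * S I))"
        unfolding T_def sum_distrib_left using S CD by (intro sum_ennreal[symmetric]) (simp add: less_imp_le)
      also have "\<dots> \<le> (\<integral>\<^sup>+z. Q z * indicator A z \<partial>?\<mu>)"
        using S by (intro order.trans[OF _ A_ge] sum_mono) simp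
      finally show ?thesis .
    qed
    have A_meas [measurable]: "A \<in> sets ?\<mu>"
    proof -
      have eq: "particle_excess N k xbar z = 0 \<longleftrightarrow> (\<Sum>j<N. if Re (z j) \<le> xbar then 1 else 0) = real k" for z
        by (simp add: particle_excess_def sum.If_cases Int_def)
      show ?thesis unfolding A_def config_measure_def eq by measurable
    qed
    define Z where "Z = (\<integral>\<^sup>+z. Q z \<partial>?\<mu>)"
    \<comment> \<open>For \<open>Z = 0\<close> the inverse is infinite and the inequality trivial;
      an infinite \<open>Z\<close> contradicts \<open>Z_upper\<close>.\<close>
    have inv: "inverse (ennreal (C * T)) \<le> inverse Z"
    proof (cases Z rule: ennreal_cases)
      case (real z)
      then have "z \<le> C * T" using Z_upper CD T by (simp add: Z_def)
      then show ?thesis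
        using real CD T by (cases "z = 0") (auto simp: inverse_ennreal field_simps intro!: ennreal_leI)
    qed (use Z_upper in \<open>simp add: Z_def top_unique\<close>)
    have "ennreal (1 / (C / D)) = ennreal (D * T) / ennreal (C * T)"
      using CD T by (simp add: divide_ennreal)
    also have "\<dots> \<le> (\<integral>\<^sup>+z. Q z * indicator A z \<partial>?\<mu>) / Z"
      using A_lower inv unfolding divide_ennreal_def by (intro mult_mono) auto
    also have "\<dots> = (\<integral>\<^sup>+z. Q z * indicator A z / Z \<partial>?\<mu>)"
      by (rule nn_integral_divide[symmetric]) measurable
    also have "\<dots> = (\<integral>\<^sup>+z. Q z / Z * indicator A z \<partial>?\<mu>)"
      by (simp add: divide_ennreal_def mult_ac)
    also have "\<dots> = emeasure (laughlin_prob p R l N) A"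
      unfolding laughlin_prob_def Q_def[symmetric] Z_def[symmetric]
      by (rule emeasure_density[symmetric]) measurable
    finally show "let xbar = (real k - 1/2) * real p * l\<^sup>2 / R in
        emeasure (laughlin_prob p R l N) {z \<in> space (laughlin_prob p R l N). particle_excess N k xbar z = 0}
        \<ge> ennreal (1 / (C / D))"
      by (simp add: A_def xbar_def laughlin_prob_def Let_def)
  qed
qed

end
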